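(* Let $A\in\mathbb{R}^{m\times n}$ and $b\in\mathbb{R}^m$ be such that $Ax=b$ is consistent, and let $x^*$ be the minimum-norm solution of $Ax=b$. Let $\mathcal{D}$ be a probability distribution over subsets of $[m]=\{1,\dots,m\}$. Given $\lambda\ge 0$, define the random regularized projection $P_{\lambda,S}:=A_S^\top(A_SA_S^\top+\lambda I)^\dagger A_S$ for $S\sim\mathcal{D}$, and suppose that $\bar P_\lambda:=\mathbb{E}[P_{\lambda,S}]$ has the same null space as $A$. Define $$\mu:=\lambda_{\min}^+(\bar P_\lambda),\qquad \nu:=\lambda_{\max}\Big(\mathbb{E}\big[(\bar P_\lambda^{\dagger/2}P_{\lambda,S}\bar P_\lambda^{\dagger/2})^2\big]\Big),\qquad \bar\rho:=\sqrt{\mu/\nu}.$$ Let $\rho\in[0,c\bar\rho]$ and $\eta\in[\frac{c}{\nu},\frac{1}{2\nu}]$ for some $c\in(0,1/2]$. Starting from $x_0\in\mathbb{R}^n$ and $m_0=0$, suppose that a sequence $x_t$ is updated for $t=0,1,2,\dots$ as follows: draw a random $S\sim\mathcal{D}$ (independently in each step); let $w_t:=A_S^\top(A_SA_S^\top+\lambda I)^\dagger(A_Sx_t-b_S)$ be the exact regularized projection step; compute it possibly inexactly as $\tilde w_t$ with $\|\tilde w_t-w_t\|\le\frac{\rho^2}{8\eta}\|x_t-x^*\|$; set $$m_{t+1}=\frac{1-\rho}{1+\rho}(m_t-\tilde w_t),\qquad x_{t+1}=x_t-\tilde w_t+\eta\, m_{t+1}.$$ Then $$\mathbb{E}\big[\|x_t-x^*\|^2\big]\le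 8\,(1-\rho/2)^t\,\|x_0-x^*\|^2.$$
   Context: $A_S$ denotes the submatrix of rows of $A$ indexed by $S$, and $b_S$ the corresponding subvector of $b$. $M^\dagger$ is the Moore-Penrose pseudoinverse and, for a positive semidefinite $M$, $M^{\dagger/2}=(M^\dagger)^{1/2}$. $\lambda_{\max}(M)$ and $\lambda_{\min}^+(M)$ denote the largest and the smallest positive eigenvalue of a positive semidefinite matrix $M$. $\|\cdot\|$ is the Euclidean norm.
   Formalization: The formal theorem additionally assumes that x_0 lies in the row space of A and that every computed step w̃_t lies almost surely in the row space of A; without these the claim fails for rank-deficient A, since null-space components are never corrected. *)

theory Defs
  imports "HOL-Probability.Probability"
begin

text \<open>The Moore-Penrose pseudoinverse, as the unique solution of the four Penrose equations.\<close>

definition pinv :: "real^'n^'m \<Rightarrow> real^'m^'n" where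
  "pinv M = (THE X. M ** X ** M = M \<and> X ** M ** X = X \<and>
                    transpose (M ** X) = M ** X \<and> transpose (X ** M) = X ** M)"

definition psd :: "real^'n^'n \<Rightarrow> bool" where
  "psd M \<longleftrightarrow> transpose M = M \<and> (\<forall>v. 0 \<le> v \<bullet> (M *v v))"

definition psd_sqrt :: "real^'n^'n \<Rightarrow> real^'n^'n" where
  "psd_sqrt M = (THE X. psd X \<and> X ** X = M)"

definition eigenvalues :: "real^'n^'n \<Rightarrow> real set" where
  "eigenvalues M = {l. \<exists>v. v \<noteq> 0 \<and> M *v v = l *\<^sub>R v}"

definition lambda_max :: "real^'n^'n \<Rightarrow> real" where
  "lambda_max M = Max (eigenvalues M)"

definition lambda_min_pos :: "real^'n^'n \<Rightarrow> real" where
  "lambda_min_pos M = Min {l \<in> eigenvalues M. 0 < l}"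

text \<open>
  Submatrices indexed by a row set \<open>S\<close>: a matrix (vector) whose row index set is \<open>S\<close> is stored
  with the full index type and zeros outside \<open>S\<close>, so an \<open>S \<times> S\<close> matrix lives in the corner of
  matrices vanishing outside \<open>S \<times> S\<close>. There \<open>mat_rows S\<close>, not \<open>mat 1\<close>, is the identity matrix.
  Products and transposes are those of the genuine submatrices, and so is the pseudoinverse:
  if \<open>X\<close> satisfies the Penrose equations for \<open>M\<close>, then \<open>X = M\<^sup>T X\<^sup>T X = X X\<^sup>T M\<^sup>T\<close>, hence \<open>X\<close>
  vanishes outside \<open>S \<times> S\<close> whenever \<open>M\<close> does.
\<close>

definition restrict_rows :: "real^'n^'m \<Rightarrow> 'm set \<Rightarrow> real^'n^'m" where
  "restrict_rows A S = (\<chi> i j. if i \<in> S then A $ i $ j else 0)"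

definition restrict_vec :: "real^'m \<Rightarrow> 'm set \<Rightarrow> real^'m" where
  "restrict_vec b S = (\<chi> i. if i \<in> S then b $ i else 0)"

definition mat_rows :: "'m set \<Rightarrow> real^'m^'m" where
  "mat_rows S = (\<chi> i j. if i \<in> S \<and> i = j then 1 else 0)"

text \<open>\<open>A\<^sub>S\<^sup>T (A\<^sub>S A\<^sub>S\<^sup>T + \<lambda> I)\<^sup>\<dagger>\<close>, the factor common to \<open>P\<^sub>\<lambda>\<^sub>,\<^sub>S\<close> and the projection step.\<close>

definition reg_factor :: "real^'n^'m \<Rightarrow> real \<Rightarrow> 'm set \<Rightarrow> real^'m^'n" where
  "reg_factor A lam S =
     transpose (restrict_rows A S) **
     pinv (restrict_rows A S ** transpose (restrict_rows A S) + lam *\<^sub>R mat_rows S)"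

definition reg_proj :: "real^'n^'m \<Rightarrow> real \<Rightarrow> 'm set \<Rightarrow> real^'n^'n" where
  "reg_proj A lam S = reg_factor A lam S ** restrict_rows A S"

definition reg_step :: "real^'n^'m \<Rightarrow> real^'m \<Rightarrow> real \<Rightarrow> 'm set \<Rightarrow> real^'n \<Rightarrow> real^'n" where
  "reg_step A b lam S x = reg_factor A lam S *v (restrict_rows A S *v x - restrict_vec b S)"

definition mean_reg_proj :: "real^'n^'m \<Rightarrow> real \<Rightarrow> 'm set pmf \<Rightarrow> real^'n^'n" where
  "mean_reg_proj A lam D = measure_pmf.expectation D (reg_proj A lam)"

definition whitened_proj :: "real^'n^'m \<Rightarrow> real \<Rightarrow> 'm set pmf \<Rightarrow> 'm set \<Rightarrow> real^'n^'n" where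
  "whitened_proj A lam D S =
     psd_sqrt (pinv (mean_reg_proj A lam D)) ** reg_proj A lam S **
     psd_sqrt (pinv (mean_reg_proj A lam D))"

end

theory Submission
  imports Defs
begin

text \<open>
  The proof is a potential-function argument for Nesterov's momentum in the geometry of the mean
  projection \<open>B = E[P\<^sub>S]\<close>. Let \<open>e = x - x*\<close> be the error of an iterate and \<open>m\<close> its momentum. Because the
  system is consistent, an exact step subtracts \<open>P\<^sub>S e\<close>, and all errors stay in the row space of \<open>A\<close>,
  where \<open>B\<close> is invertible with inverse \<open>B\<^sup>\<dagger>\<close>. The potential is

    \<open>L = q \<bullet> B\<^sup>\<dagger> q + \<gamma> |u|\<^sup>2\<close>,   \<open>q = \<rho> e + \<eta> m\<close>,   \<open>u = e - \<eta> m\<close>,   \<open>\<gamma> = \<rho> + (1 - \<rho>) \<eta>\<close>.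

  An exact step sends \<open>u\<close> to \<open>e - P\<^sub>S e\<close> and \<open>q\<close> to \<open>(1 - \<rho>) q + \<rho>\<^sup>2 e - \<gamma> P\<^sub>S e\<close>. Averaging over \<open>S\<close>
  uses three facts: \<open>B\<^sup>\<dagger> B e = e\<close>, which turns the cross term into a plain inner product;
  \<open>E[P\<^sub>S B\<^sup>\<dagger> P\<^sub>S] \<le> \<nu> B\<close> on the row space, which is the definition of \<open>\<nu>\<close> with the whitening undone
  (\<open>mean_pinv_norm_P_le\<close>); and \<open>P\<^sub>S\<^sup>2 \<le> P\<^sub>S\<close> (\<open>reg_proj_firmly_nonexpansive\<close>). They give
  \<open>E[L'] \<le> (1 - \<rho>) L\<close> as soon as \<open>\<gamma> \<nu> \<le> 1\<close> and \<open>\<rho>\<^sup>2 / \<mu> \<le> \<gamma>\<close> (\<open>mean_exact_potential_le\<close>). The ranges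
  of \<open>\<rho>\<close> and \<open>\<eta>\<close> imply both, given \<open>\<nu> \<ge> 1\<close> and \<open>\<mu> \<nu> \<le> 1\<close> (\<open>nu_ge_1\<close>, \<open>mu_nu_le_1\<close>).

  An inexact step perturbs \<open>q\<close> and \<open>u\<close> by a vector whose energy is at most \<open>\<rho>\<^sup>2 L / 16\<close>. Splitting it
  off with Young's inequality at parameter \<open>\<rho> / 4\<close> weakens the contraction factor from \<open>1 - \<rho>\<close> to
  \<open>1 - \<rho> / 2\<close> (\<open>inexact_step\<close>). Since \<open>S\<close> is independent of the history, the bound passes to
  expectations and can be iterated (\<open>expected_potential_step\<close>). Finally \<open>\<gamma> |e|\<^sup>2 \<le> 2 L\<close> at all times
  and \<open>L \<le> 2 \<gamma> |e|\<^sup>2\<close> at the start, so passing between potential and error costs a constant factor.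

  Pseudoinverses, square roots and extreme eigenvalues are all handled through an orthonormal
  eigenbasis of a symmetric matrix, constructed at the outset.
\<close>

section \<open>Spectral calculus of symmetric matrices\<close>

lemma inner_symmetric_matrix:
  fixes M :: "real^'n^'n"
  assumes "transpose M = M"
  shows "x \<bullet> (M *v y) = (M *v x) \<bullet> y"
  by (metis assms dot_lmul_matrix transpose_matrix_vector)

lemma inner_symmetric_matrix_swap:
  fixes M :: "real^'n^'n"
  assumes "transpose M = M"
  shows "x \<bullet> (M *v y) = y \<bullet> (M *v x)"
  by (metis assms inner_symmetric_matrix inner_commute)

lemma symmetric_matrixI:
  fixes M :: "real^'n^'n"
  assumes "\<And>x y. x \<bullet> (M *v y) = y \<bullet> (M *v x)"
  shows "transpose M = M"
proof -
  have "(transpose M *v x) \<bullet> y = (M *v x) \<bullet> y" for x y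
    by (metis assms dot_lmul_matrix transpose_matrix_vector inner_commute)
  then have "transpose M *v x = M *v x" for x
    by (metis vector_eq_rdot)
  then show ?thesis by (simp add: matrix_eq)
qed

text \<open>
  A maximiser \<open>v\<close> of the Rayleigh quotient on \<open>W\<close> is an eigenvector: with \<open>l\<close> the maximum, the form
  \<open>l |w|\<^sup>2 - w \<bullet> M w\<close> is nonnegative on \<open>W\<close> and vanishes at \<open>v\<close>, so its derivative at \<open>v\<close> in the
  direction of the residual \<open>r = l v - M v\<close>, which is \<open>2 |r|\<^sup>2\<close>, must vanish.
\<close>

lemma symmetric_matrix_eigenvector:
  fixes M :: "real^'n^'n"
  assumes sym: "transpose M = M" and W: "subspace W" and inv: "\<And>w. w \<in> W \<Longrightarrow> M *v w \<in> W"
    and nz: "w0 \<in> W" "w0 \<noteq> 0"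
  obtains v l where "v \<in> W" "norm v = 1" "M *v v = l *\<^sub>R v"
proof -
  let ?K = "sphere 0 1 \<inter> W"
  have "compact ?K"
    by (intro compact_Int_closed compact_sphere closed_subspace W)
  moreover have "(1 / norm w0) *\<^sub>R w0 \<in> ?K"
    using nz W by (auto simp: subspace_scale)
  moreover have "continuous_on ?K (\<lambda>w. w \<bullet> (M *v w))"
    by (intro continuous_intros linear_continuous_on_compose[OF continuous_on_id] matrix_vector_mul_linear)
  ultimately obtain v where v: "v \<in> ?K" and max: "\<And>w. w \<in> ?K \<Longrightarrow> w \<bullet> (M *v w) \<le> v \<bullet> (M *v v)"
    using continuous_attains_sup[of ?K "\<lambda>w. w \<bullet> (M *v w)"] by blast
  define l where "l = v \<bullet> (M *v v)"
  have vW: "v \<in> W" and vn: "norm v = 1" using v by auto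
  have le: "w \<bullet> (M *v w) \<le> l * (w \<bullet> w)" if "w \<in> W" for w
  proof (cases "w = 0")
    case False
    have "(1 / norm w) *\<^sub>R w \<in> ?K" using that False W by (auto simp: subspace_scale)
    from max[OF this] have "(w \<bullet> (M *v w)) / (norm w)\<^sup>2 \<le> l"
      by (simp add: l_def matrix_vector_mult_scaleR power2_eq_square)
    then show ?thesis using False by (simp add: power2_norm_eq_inner field_simps)
  qed simp
  define r where "r = l *\<^sub>R v - M *v v"
  have rW: "r \<in> W" unfolding r_def using vW W inv by (simp add: subspace_diff subspace_scale)
  have pos: "0 \<le> 2 * t * (r \<bullet> r) + t\<^sup>2 * (l * (r \<bullet> r) - r \<bullet> (M *v r))" for t
  proof -
    have "v + t *\<^sub>R r \<in> W" using vW rW W by (simp add: subspace_add subspace_scale)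
    from le[OF this]
    have "l + t * (v \<bullet> (M *v r) + r \<bullet> (M *v v)) + t\<^sup>2 * (r \<bullet> (M *v r))
        \<le> l * (1 + 2 * t * (v \<bullet> r) + t\<^sup>2 * (r \<bullet> r))"
      using vn by (simp add: matrix_vector_right_distrib matrix_vector_mult_scaleR inner_add_left
         inner_add_right l_def[symmetric] norm_eq_1 inner_commute[of r v] power2_eq_square algebra_simps)
    moreover have "v \<bullet> (M *v r) = r \<bullet> (M *v v)"
      using inner_symmetric_matrix[OF sym, of v r] by (simp add: inner_commute)
    moreover have "2 * t * (r \<bullet> r) = 2 * t * (l * (v \<bullet> r)) - 2 * t * (r \<bullet> (M *v v))"
    proof -
      have "r \<bullet> r = l * (v \<bullet> r) - r \<bullet> (M *v v)"
        by (subst (2) r_def) (simp add: inner_diff_right inner_commute)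
      then show ?thesis by (simp add: right_diff_distrib)
    qed
    ultimately show ?thesis by (simp add: algebra_simps)
  qed
  have "r \<bullet> r = 0"
  proof (rule ccontr)
    assume "r \<bullet> r \<noteq> 0"
    then have a: "0 < r \<bullet> r" by simp
    define d where "d = l * (r \<bullet> r) - r \<bullet> (M *v r)"
    \<comment> \<open>a step against \<open>r\<close>, short enough for the first-order term to dominate the second-order one\<close>
    define t where "t = - (r \<bullet> r) / (\<bar>d\<bar> + 1)"
    have "t < 0" using a by (simp add: t_def divide_neg_pos)
    have "\<bar>t * d\<bar> \<le> r \<bullet> r"
      using a by (simp add: t_def abs_mult field_simps)
    then have "0 < 2 * (r \<bullet> r) + t * d" using a by linarith
    then have "t * (2 * (r \<bullet> r) + t * d) < 0" using \<open>t < 0\<close> by (simp add: mult_neg_pos)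
    with pos[of t] show False by (simp add: d_def algebra_simps power2_eq_square)
  qed
  then have "M *v v = l *\<^sub>R v" by (simp add: r_def)
  then show ?thesis using that vW vn by blast
qed

definition orthonormal_eigenbasis :: "real^'n^'n \<Rightarrow> (real^'n) set \<Rightarrow> (real^'n) set \<Rightarrow> bool" where
  "orthonormal_eigenbasis M W E \<longleftrightarrow> finite E \<and> pairwise orthogonal E \<and> (\<forall>v\<in>E. norm v = 1) \<and>
     span E = W \<and> (\<forall>v\<in>E. \<exists>l. M *v v = l *\<^sub>R v)"

text \<open>
  The orthogonal complement of an eigenvector is again invariant, so eigenvectors can be split off
  one at a time.
\<close>

lemma symmetric_matrix_eigenbasis_invariant:
  fixes M :: "real^'n^'n"
  assumes sym: "transpose M = M"
  shows "subspace W \<Longrightarrow> (\<And>w. w \<in> W \<Longrightarrow> M *v w \<in> W) \<Longrightarrow> \<exists>E. orthonormal_eigenbasis M W E"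
proof (induction "dim W" arbitrary: W rule: less_induct)
  case less
  show ?case
  proof (cases "W = {0}")
    case True
    then have "orthonormal_eigenbasis M W {}" by (simp add: orthonormal_eigenbasis_def)
    then show ?thesis by blast
  next
    case False
    then obtain w0 where "w0 \<in> W" "w0 \<noteq> 0" using subspace_0[OF less(2)] by blast
    then obtain v l where v: "v \<in> W" "norm v = 1" and ev: "M *v v = l *\<^sub>R v"
      using symmetric_matrix_eigenvector[OF sym less(2,3)] by metis
    have vv: "v \<bullet> v = 1" using v by (simp add: norm_eq_1)
    let ?W = "{w \<in> W. v \<bullet> w = 0}"
    have sub: "subspace ?W"
      using less(2) by (auto simp: subspace_def inner_add_right)
    have inv: "M *v w \<in> ?W" if "w \<in> ?W" for w
      using that less(3)[of w] inner_symmetric_matrix[OF sym, of v w] ev by simp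
    have "dim ?W < dim W"
    proof (rule dim_psubset)
      have "v \<notin> span ?W" using vv sub by (simp add: span_eq_iff[THEN iffD2])
      then show "span ?W \<subset> span W"
        using v span_mono[of ?W W] span_base by blast
    qed
    from less(1)[OF this sub inv] obtain E where E: "orthonormal_eigenbasis M ?W E" by blast
    have EW: "E \<subseteq> ?W" using E span_superset unfolding orthonormal_eigenbasis_def by blast
    have "span (insert v E) = W"
    proof
      show "span (insert v E) \<subseteq> W"
        using EW v less(2) by (intro span_minimal) auto
      show "W \<subseteq> span (insert v E)"
      proof
        fix w assume w: "w \<in> W"
        have "w - (v \<bullet> w) *\<^sub>R v \<in> ?W"
          using w v less(2) vv by (auto simp: subspace_diff subspace_scale inner_diff_right)
        then have "w - (v \<bullet> w) *\<^sub>R v \<in> span E" using E by (simp add: orthonormal_eigenbasis_def)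
        then show "w \<in> span (insert v E)" using span_breakdown_eq by blast
      qed
    qed
    then have "orthonormal_eigenbasis M W (insert v E)"
      using E EW v ev unfolding orthonormal_eigenbasis_def
      by (auto simp: pairwise_insert orthogonal_def inner_commute)
    then show ?thesis by blast
  qed
qed

definition eigenbasis :: "real^'n^'n \<Rightarrow> (real^'n) set" where
  "eigenbasis M = (SOME E. orthonormal_eigenbasis M UNIV E)"

text \<open>
  Functional calculus \<open>f(M) = \<Sum> f(l\<^sub>v) v v\<^sup>T\<close> over an orthonormal eigenbasis. As the basis vectors are
  unit vectors, the eigenvalue \<open>l\<^sub>v\<close> is the Rayleigh quotient \<open>v \<bullet> M v\<close>. Pseudoinverse and square root
  are the instances \<open>f = inverse\<close> and \<open>f = sqrt\<close>.
\<close>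

definition spectral_fun :: "real^'n^'n \<Rightarrow> (real \<Rightarrow> real) \<Rightarrow> real^'n^'n" where
  "spectral_fun M f = matrix (\<lambda>x. \<Sum>v\<in>eigenbasis M. (f (v \<bullet> (M *v v)) * (v \<bullet> x)) *\<^sub>R v)"

context
  fixes M :: "real^'n^'n"
  assumes sym: "transpose M = M"
begin

lemma orthonormal_eigenbasis: "orthonormal_eigenbasis M UNIV (eigenbasis M)"
  unfolding eigenbasis_def
  by (rule someI_ex) (rule symmetric_matrix_eigenbasis_invariant[OF sym]; simp)

lemma finite_eigenbasis: "finite (eigenbasis M)"
  using orthonormal_eigenbasis by (simp add: orthonormal_eigenbasis_def)

lemma eigenbasis_inner: "v \<in> eigenbasis M \<Longrightarrow> w \<in> eigenbasis M \<Longrightarrow> v \<bullet> w = (if v = w then 1 else 0)"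
  using orthonormal_eigenbasis
  by (auto simp: orthonormal_eigenbasis_def pairwise_def orthogonal_def norm_eq_1)

lemma eigenbasis_eigenvector:
  assumes "v \<in> eigenbasis M" shows "M *v v = (v \<bullet> (M *v v)) *\<^sub>R v"
proof -
  obtain l where "M *v v = l *\<^sub>R v" using assms orthonormal_eigenbasis unfolding orthonormal_eigenbasis_def by blast
  then show ?thesis using eigenbasis_inner[OF assms assms] by simp
qed

lemma eigenbasis_expand: "(\<Sum>v\<in>eigenbasis M. (v \<bullet> x) *\<^sub>R v) = x"
  using orthonormal_basis_expand[of "eigenbasis M" x] orthonormal_eigenbasis
  by (simp add: orthonormal_eigenbasis_def inner_commute)

lemma eigenbasis_matrix_eqI:
  assumes "\<And>v. v \<in> eigenbasis M \<Longrightarrow> X *v v = Y *v v" shows "X = (Y :: real^'n^'m)"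
proof -
  have "X *v x = Y *v x" for x
  proof (rule linear_eq_on_span[of "(*v) X" "(*v) Y" "eigenbasis M"])
    show "x \<in> span (eigenbasis M)"
      using orthonormal_eigenbasis by (simp add: orthonormal_eigenbasis_def)
  qed (use assms in auto)
  then show ?thesis by (simp add: matrix_eq)
qed

lemma spectral_fun_apply:
  "spectral_fun M f *v x = (\<Sum>v\<in>eigenbasis M. (f (v \<bullet> (M *v v)) * (v \<bullet> x)) *\<^sub>R v)"
proof -
  have "linear (\<lambda>x. \<Sum>v\<in>eigenbasis M. (f (v \<bullet> (M *v v)) * (v \<bullet> x)) *\<^sub>R v)"
    by (rule linearI) (simp_all add: inner_add_right algebra_simps sum.distrib scaleR_sum_right)
  then show ?thesis unfolding spectral_fun_def by (simp add: matrix_works)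
qed

lemma spectral_fun_eigenbasis:
  assumes "v \<in> eigenbasis M"
  shows "spectral_fun M f *v v = f (v \<bullet> (M *v v)) *\<^sub>R v"
proof -
  have "spectral_fun M f *v v = (\<Sum>w\<in>eigenbasis M. if v = w then f (w \<bullet> (M *v w)) *\<^sub>R w else 0)"
    unfolding spectral_fun_apply using assms by (intro sum.cong) (auto simp: eigenbasis_inner)
  then show ?thesis using assms finite_eigenbasis by simp
qed

lemma spectral_fun_inner:
  "x \<bullet> (spectral_fun M f *v y) = (\<Sum>v\<in>eigenbasis M. f (v \<bullet> (M *v v)) * (v \<bullet> x) * (v \<bullet> y))"
  by (simp add: spectral_fun_apply inner_sum_right mult_ac inner_commute)

lemma spectral_fun_symmetric: "transpose (spectral_fun M f) = spectral_fun M f"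
  by (rule symmetric_matrixI) (simp add: spectral_fun_inner mult_ac)

lemma spectral_fun_mult: "spectral_fun M f ** spectral_fun M g = spectral_fun M (\<lambda>l. f l * g l)"
  by (rule eigenbasis_matrix_eqI)
    (simp add: matrix_vector_mul_assoc[symmetric] spectral_fun_eigenbasis matrix_vector_mult_scaleR mult.commute)

lemma spectral_fun_id: "spectral_fun M (\<lambda>l. l) = M"
  by (rule eigenbasis_matrix_eqI) (metis spectral_fun_eigenbasis eigenbasis_eigenvector)

lemma inner_eigenbasis: "x \<bullet> y = (\<Sum>v\<in>eigenbasis M. (v \<bullet> x) * (v \<bullet> y))"
proof -
  have "x \<bullet> y = x \<bullet> (\<Sum>v\<in>eigenbasis M. (v \<bullet> y) *\<^sub>R v)" by (simp only: eigenbasis_expand)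
  then show ?thesis by (simp add: inner_sum_right mult_ac inner_commute)
qed

lemma spectral_fun_eqI:
  assumes "\<And>v. v \<in> eigenbasis M \<Longrightarrow> f (v \<bullet> (M *v v)) = g (v \<bullet> (M *v v))"
  shows "spectral_fun M f = spectral_fun M g"
  by (rule eigenbasis_matrix_eqI) (simp add: spectral_fun_eigenbasis assms)

lemma eigenvalues_eq: "eigenvalues M = (\<lambda>v. v \<bullet> (M *v v)) ` eigenbasis M"
proof
  show "(\<lambda>v. v \<bullet> (M *v v)) ` eigenbasis M \<subseteq> eigenvalues M"
  proof
    fix l assume "l \<in> (\<lambda>v. v \<bullet> (M *v v)) ` eigenbasis M"
    then obtain v where v: "v \<in> eigenbasis M" "l = v \<bullet> (M *v v)" by blast
    moreover have "v \<noteq> 0" using eigenbasis_inner[OF v(1) v(1)] by auto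
    ultimately show "l \<in> eigenvalues M" using eigenbasis_eigenvector[of v] unfolding eigenvalues_def by blast
  qed
  show "eigenvalues M \<subseteq> (\<lambda>v. v \<bullet> (M *v v)) ` eigenbasis M"
  proof
    fix l assume "l \<in> eigenvalues M"
    then obtain x where x: "x \<noteq> 0" "M *v x = l *\<^sub>R x" by (auto simp: eigenvalues_def)
    have "\<exists>v\<in>eigenbasis M. v \<bullet> x \<noteq> 0"
    proof (rule ccontr)
      assume "\<not> ?thesis"
      then have "(\<Sum>v\<in>eigenbasis M. (v \<bullet> x) *\<^sub>R v) = 0" by simp
      then show False using x eigenbasis_expand by simp
    qed
    then obtain v where v: "v \<in> eigenbasis M" "v \<bullet> x \<noteq> 0" by blast
    have "l * (v \<bullet> x) = v \<bullet> (M *v x)" using x by simp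
    also have "\<dots> = (v \<bullet> (M *v v)) * (v \<bullet> x)"
      using inner_symmetric_matrix[OF sym, of v x] eigenbasis_eigenvector[OF v(1)] by (metis inner_scaleR_left)
    finally show "l \<in> (\<lambda>v. v \<bullet> (M *v v)) ` eigenbasis M" using v by simp
  qed
qed

lemma finite_eigenvalues: "finite (eigenvalues M)"
  by (simp add: eigenvalues_eq finite_eigenbasis)

lemma eigenvalues_nonempty: "eigenvalues M \<noteq> {}"
proof -
  have "eigenbasis M \<noteq> {}"
    using eigenbasis_expand[of "axis undefined 1"] by (auto simp: axis_eq_0_iff)
  then show ?thesis by (simp add: eigenvalues_eq)
qed

lemma lambda_max_eigenvalue: "lambda_max M \<in> eigenvalues M"
  unfolding lambda_max_def by (rule Max_in[OF finite_eigenvalues eigenvalues_nonempty])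

lemma spectral_fun_inner_le:
  assumes "\<And>l. l \<in> eigenvalues M \<Longrightarrow> f l \<le> k"
  shows "x \<bullet> (spectral_fun M f *v x) \<le> k * (x \<bullet> x)"
  unfolding spectral_fun_inner inner_eigenbasis[of x x] sum_distrib_left
  using assms by (intro sum_mono) (auto simp: eigenvalues_eq mult.assoc intro!: mult_right_mono)

lemma inner_le_lambda_max: "x \<bullet> (M *v x) \<le> lambda_max M * (x \<bullet> x)"
  using spectral_fun_inner_le[of "\<lambda>l. l" "lambda_max M" x]
  by (simp add: spectral_fun_id lambda_max_def finite_eigenvalues)

end

lemma psd_spectral_fun:
  assumes "transpose M = M" "\<And>l. l \<in> eigenvalues M \<Longrightarrow> 0 \<le> f l"
  shows "psd (spectral_fun M f)"
  unfolding psd_def spectral_fun_inner[OF assms(1)]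
  using assms by (auto simp: spectral_fun_symmetric eigenvalues_eq mult.assoc intro!: sum_nonneg)

lemma psd_eigenvalue_nonneg:
  assumes "psd M" "l \<in> eigenvalues M" shows "0 \<le> l"
proof -
  have "transpose M = M" using assms by (simp add: psd_def)
  then show ?thesis using assms by (auto simp: eigenvalues_eq psd_def)
qed

lemma lambda_min_pos:
  assumes "psd M" "M \<noteq> 0"
  shows "0 < lambda_min_pos M"
    "\<And>l. l \<in> eigenvalues M \<Longrightarrow> 0 < l \<Longrightarrow> lambda_min_pos M \<le> l"
proof -
  have sym: "transpose M = M" using assms by (simp add: psd_def)
  have fin: "finite {l \<in> eigenvalues M. 0 < l}" using finite_eigenvalues[OF sym] by simp
  have "{l \<in> eigenvalues M. 0 < l} \<noteq> {}"
  proof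
    assume "{l \<in> eigenvalues M. 0 < l} = {}"
    then have *: "l = 0" if "l \<in> eigenvalues M" for l
      using psd_eigenvalue_nonneg[OF assms(1) that] that by force
    have "M *v v = 0 *v v" if "v \<in> eigenbasis M" for v
    proof -
      have "v \<bullet> (M *v v) = 0" using that by (intro *) (simp add: eigenvalues_eq[OF sym])
      then show ?thesis using eigenbasis_eigenvector[OF sym that] by simp
    qed
    then have "M = 0" by (rule eigenbasis_matrix_eqI[OF sym])
    then show False using assms by simp
  qed
  from Min_in[OF fin this] show "0 < lambda_min_pos M"
    by (auto simp: lambda_min_pos_def)
  show "lambda_min_pos M \<le> l" if "l \<in> eigenvalues M" "0 < l" for l
    unfolding lambda_min_pos_def using that fin by (intro Min_le) auto
qed

text \<open>
  Any two solutions of the Penrose equations agree: \<open>M X\<close> and \<open>M Y\<close> are both the orthogonal projection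
  onto the range of \<open>M\<close>, likewise \<open>X M = Y M\<close>, hence \<open>X = X M X = Y M X = Y M Y = Y\<close>.
\<close>

lemma pinv_eqI:
  assumes "M ** X ** M = M" "X ** M ** X = X"
    "transpose (M ** X) = M ** X" "transpose (X ** M) = X ** M"
  shows "pinv M = X"
  unfolding pinv_def
proof (rule the_equality)
  show "M ** X ** M = M \<and> X ** M ** X = X \<and>
      transpose (M ** X) = M ** X \<and> transpose (X ** M) = X ** M" using assms by simp
next
  fix Y assume Y: "M ** Y ** M = M \<and> Y ** M ** Y = Y \<and>
      transpose (M ** Y) = M ** Y \<and> transpose (Y ** M) = Y ** M"
  have "M ** X = M ** Y ** (M ** X)" using Y by (simp add: matrix_mul_assoc)
  also have "\<dots> = transpose (M ** X ** (M ** Y))"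
    using Y assms by (metis matrix_transpose_mul)
  also have "\<dots> = M ** Y" using Y assms by (simp add: matrix_mul_assoc)
  finally have 1: "M ** X = M ** Y" .
  have "X ** M = X ** M ** (Y ** M)" using Y by (metis matrix_mul_assoc)
  also have "\<dots> = transpose (Y ** M ** (X ** M))"
    using Y assms by (metis matrix_transpose_mul)
  also have "\<dots> = Y ** M" using Y assms by (metis matrix_mul_assoc)
  finally have 2: "X ** M = Y ** M" .
  show "Y = X" using 1 2 Y assms by (metis matrix_mul_assoc)
qed

text \<open>
  Since \<open>inverse 0 = 0\<close>, inverting the eigenvalues pointwise leaves the kernel alone, as the
  pseudoinverse must.
\<close>

lemma
  assumes sym: "transpose M = M"
  shows pinv_eq_spectral_fun: "pinv M = spectral_fun M inverse"
    and mult_pinv_mult: "M ** pinv M ** M = M" "pinv M ** M ** pinv M = pinv M"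
    and pinv_commute: "M ** pinv M = pinv M ** M"
    and transpose_pinv: "transpose (pinv M) = pinv M"
proof -
  let ?X = "spectral_fun M inverse"
  note id = spectral_fun_id[OF sym]
  have MX: "M ** ?X = spectral_fun M (\<lambda>l. l * inverse l)"
    using spectral_fun_mult[OF sym, of "\<lambda>l. l" inverse] by (simp add: id)
  have XM: "?X ** M = spectral_fun M (\<lambda>l. l * inverse l)"
    using spectral_fun_mult[OF sym, of inverse "\<lambda>l. l"] by (simp add: id mult.commute)
  have 1: "transpose (M ** ?X) = M ** ?X" "transpose (?X ** M) = ?X ** M"
    unfolding MX XM by (simp_all add: spectral_fun_symmetric[OF sym])
  have "M ** ?X ** M = spectral_fun M (\<lambda>l. (l * inverse l) * l)"
    unfolding MX using spectral_fun_mult[OF sym, of "\<lambda>l. l * inverse l" "\<lambda>l. l"] by (simp add: id)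
  also have "\<dots> = spectral_fun M (\<lambda>l. l)"
    by (rule spectral_fun_eqI[OF sym]) (simp add: field_simps)
  finally have 2: "M ** ?X ** M = M" by (simp add: id)
  have "?X ** M ** ?X = spectral_fun M (\<lambda>l. (l * inverse l) * inverse l)"
    unfolding XM by (rule spectral_fun_mult[OF sym])
  also have "\<dots> = ?X"
    by (rule spectral_fun_eqI[OF sym]) (simp add: field_simps)
  finally have 3: "?X ** M ** ?X = ?X" .
  show eq: "pinv M = ?X" by (rule pinv_eqI[OF 2 3 1])
  show "M ** pinv M ** M = M" "pinv M ** M ** pinv M = pinv M" "M ** pinv M = pinv M ** M"
    "transpose (pinv M) = pinv M"
    unfolding eq using 2 3 MX XM spectral_fun_symmetric[OF sym] by simp_all
qed

lemma psd_pinv: "psd M \<Longrightarrow> psd (pinv M)"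
  using psd_spectral_fun[of M inverse] psd_eigenvalue_nonneg[of M]
  by (auto simp: pinv_eq_spectral_fun psd_def)

lemma pinv_inner_le:
  assumes "psd M" "M \<noteq> 0"
  shows "x \<bullet> (pinv M *v x) \<le> (x \<bullet> x) / lambda_min_pos M"
proof -
  have sym: "transpose M = M" using assms by (simp add: psd_def)
  have "inverse l \<le> inverse (lambda_min_pos M)" if "l \<in> eigenvalues M" for l
    using lambda_min_pos[OF assms] psd_eigenvalue_nonneg[OF assms(1) that] that
    by (cases "l = 0") auto
  from spectral_fun_inner_le[OF sym this, of _ x] show ?thesis
    by (simp add: pinv_eq_spectral_fun[OF sym] divide_inverse mult.commute)
qed

text \<open>
  Let \<open>X v = s v\<close> with \<open>s \<ge> 0\<close>. Then \<open>(Y + s I) (Y v - s v) = 0\<close>; for \<open>s > 0\<close> the first factor is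
  positive definite, and for \<open>s = 0\<close> the equation says \<open>|Y v|\<^sup>2 = 0\<close>. So \<open>Y\<close> agrees with \<open>X\<close> on an
  eigenbasis of \<open>X\<close>.
\<close>

lemma psd_square_root_unique:
  assumes X: "psd X" and Y: "psd Y" and eq: "X ** X = Y ** Y" shows "X = Y"
proof -
  have symX: "transpose X = X" and symY: "transpose Y = Y" using X Y by (auto simp: psd_def)
  show ?thesis
  proof (rule eigenbasis_matrix_eqI[OF symX])
    fix v assume v: "v \<in> eigenbasis X"
    define s where "s = v \<bullet> (X *v v)"
    have Xv: "X *v v = s *\<^sub>R v" using eigenbasis_eigenvector[OF symX v] by (simp add: s_def)
    have s0: "0 \<le> s" using X by (simp add: psd_def s_def)
    have YY: "Y *v (Y *v v) = (s * s) *\<^sub>R v"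
      using eq Xv by (metis matrix_vector_mul_assoc matrix_vector_mult_scaleR scaleR_scaleR)
    show "X *v v = Y *v v"
    proof (cases "s = 0")
      case True
      then have "(Y *v v) \<bullet> (Y *v v) = 0"
        using YY inner_symmetric_matrix[OF symY, of v "Y *v v"] by simp
      then show ?thesis using Xv True by simp
    next
      case False
      define w where "w = Y *v v - s *\<^sub>R v"
      have "Y *v w = - s *\<^sub>R w"
        by (simp add: w_def matrix_vector_mult_diff_distrib matrix_vector_mult_scaleR YY algebra_simps)
      then have "w \<bullet> (Y *v w) = - s * (w \<bullet> w)" by simp
      moreover have "0 \<le> w \<bullet> (Y *v w)" using Y by (simp add: psd_def)
      ultimately have "s * (w \<bullet> w) \<le> 0" by simp
      then have "w \<bullet> w \<le> 0" using False s0 by (simp add: mult_le_0_iff)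
      then have "w = 0" using inner_ge_zero[of w] by (metis inner_eq_zero_iff order_antisym)
      then show ?thesis using Xv by (simp add: w_def)
    qed
  qed
qed

lemma psd_sqrt:
  assumes "psd M" shows "psd (psd_sqrt M)" "psd_sqrt M ** psd_sqrt M = M"
proof -
  have sym: "transpose M = M" using assms by (simp add: psd_def)
  have ps: "psd (spectral_fun M sqrt)"
    using psd_spectral_fun[OF sym] psd_eigenvalue_nonneg[OF assms] by simp
  have "spectral_fun M (\<lambda>l. sqrt l * sqrt l) = spectral_fun M (\<lambda>l. l)"
    using assms by (intro spectral_fun_eqI[OF sym]) (simp add: psd_def)
  then have sq: "spectral_fun M sqrt ** spectral_fun M sqrt = M"
    using spectral_fun_mult[OF sym] spectral_fun_id[OF sym] by simp
  have "psd_sqrt M = spectral_fun M sqrt"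
    unfolding psd_sqrt_def
  proof (rule the_equality)
    show "X = spectral_fun M sqrt" if "psd X \<and> X ** X = M" for X
      using that sq by (intro psd_square_root_unique[OF _ ps]) simp_all
  qed (use ps sq in simp)
  then show "psd (psd_sqrt M)" "psd_sqrt M ** psd_sqrt M = M" using ps sq by auto
qed

section \<open>The regularized projection of one sample\<close>

lemma inner_matrix_vector_mult:
  fixes X :: "real^'n^'m"
  shows "x \<bullet> (X *v y) = (transpose X *v x) \<bullet> y"
  by (metis dot_lmul_matrix transpose_matrix_vector)

lemma transpose_mult_vec_in_span_rows:
  fixes X :: "real^'n^'m"
  shows "transpose X *v z \<in> span (rows X)"
  using matrix_vector_mult_in_columnspace[of "transpose X" z] by simp

lemma restrict_rows_mult_vec: "restrict_rows A S *v y = restrict_vec (A *v y) S"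
  by (auto simp: restrict_rows_def restrict_vec_def matrix_vector_mult_def vec_eq_iff)

lemma transpose_restrict_rows_mult_vec:
  "transpose (restrict_rows A S) *v z = transpose A *v restrict_vec z S"
  by (auto simp: restrict_rows_def restrict_vec_def matrix_vector_mult_def transpose_def vec_eq_iff
      intro!: sum.cong)

lemma mat_rows_mult_vec: "mat_rows S *v y = restrict_vec y S"
  by (auto simp: mat_rows_def restrict_vec_def matrix_vector_mult_def vec_eq_iff if_distrib[of "\<lambda>x. x * _"] cong: if_cong)

lemma inner_restrict_vec: "x \<bullet> restrict_vec y S = restrict_vec x S \<bullet> restrict_vec y S"
  by (auto simp: restrict_vec_def inner_vec_def intro!: sum.cong)

text \<open>
  The matrix \<open>A\<^sub>S A\<^sub>S\<^sup>T + \<lambda> I\<close> that is pseudoinverted in the regularized projection.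
\<close>

definition reg_gram :: "real^'n^'m \<Rightarrow> real \<Rightarrow> 'm set \<Rightarrow> real^'m^'m" where
  "reg_gram A lam S = restrict_rows A S ** transpose (restrict_rows A S) + lam *\<^sub>R mat_rows S"

lemma inner_reg_gram:
  "x \<bullet> (reg_gram A lam S *v y) =
     (transpose (restrict_rows A S) *v x) \<bullet> (transpose (restrict_rows A S) *v y)
     + lam * (restrict_vec x S \<bullet> restrict_vec y S)"
  by (simp add: reg_gram_def matrix_vector_mult_add_rdistrib inner_add_right
      scaleR_matrix_vector_assoc[symmetric] mat_rows_mult_vec inner_restrict_vec[of x]
      inner_matrix_vector_mult[of x "restrict_rows A S"] matrix_vector_mul_assoc[symmetric])

lemma psd_reg_gram: "0 \<le> lam \<Longrightarrow> psd (reg_gram A lam S)"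
  unfolding psd_def
  by (intro conjI allI symmetric_matrixI) (auto simp: inner_reg_gram inner_commute)

lemma reg_proj_apply:
  "reg_proj A lam S *v x =
     transpose (restrict_rows A S) *v (pinv (reg_gram A lam S) *v (restrict_rows A S *v x))"
  by (simp add: reg_proj_def reg_factor_def reg_gram_def matrix_vector_mul_assoc[symmetric])

lemma reg_proj_in_row_space: "reg_proj A lam S *v x \<in> span (rows A)"
  unfolding reg_proj_apply transpose_restrict_rows_mult_vec by (rule transpose_mult_vec_in_span_rows)

lemma inner_reg_proj:
  "x \<bullet> (reg_proj A lam S *v y) =
     (restrict_rows A S *v x) \<bullet> (pinv (reg_gram A lam S) *v (restrict_rows A S *v y))"
  unfolding reg_proj_apply inner_matrix_vector_mult[of x "transpose (restrict_rows A S)"] transpose_transpose ..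

lemma transpose_reg_proj:
  assumes "0 \<le> lam" shows "transpose (reg_proj A lam S) = reg_proj A lam S"
proof -
  have "transpose (pinv (reg_gram A lam S)) = pinv (reg_gram A lam S)"
    using psd_reg_gram[OF assms, of A S] by (intro transpose_pinv) (simp add: psd_def)
  then show ?thesis
    by (intro symmetric_matrixI) (simp add: inner_reg_proj inner_symmetric_matrix_swap)
qed

text \<open>
  The operator inequality \<open>P\<^sup>2 \<le> P\<close>: it holds because \<open>A\<^sub>S A\<^sub>S\<^sup>T\<close> is at most the regularized Gram
  matrix \<open>K\<close>, and \<open>K\<^sup>\<dagger> K K\<^sup>\<dagger> = K\<^sup>\<dagger>\<close>.
\<close>

lemma reg_proj_firmly_nonexpansive:
  assumes "0 \<le> lam"
  shows "(reg_proj A lam S *v x) \<bullet> (reg_proj A lam S *v x) \<le> x \<bullet> (reg_proj A lam S *v x)"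
proof -
  let ?K = "reg_gram A lam S" and ?y = "restrict_rows A S *v x"
  have sym: "transpose ?K = ?K" using psd_reg_gram[OF assms, of A S] by (simp add: psd_def)
  have "(reg_proj A lam S *v x) \<bullet> (reg_proj A lam S *v x) \<le> (pinv ?K *v ?y) \<bullet> (?K *v (pinv ?K *v ?y))"
    unfolding inner_reg_gram reg_proj_apply using assms by simp
  also have "\<dots> = ?y \<bullet> ((pinv ?K ** ?K ** pinv ?K) *v ?y)"
    using inner_symmetric_matrix[OF transpose_pinv[OF sym], symmetric]
    by (simp add: matrix_vector_mul_assoc[symmetric])
  also have "\<dots> = x \<bullet> (reg_proj A lam S *v x)"
    by (simp add: mult_pinv_mult[OF sym] inner_reg_proj)
  finally show ?thesis .
qed

text \<open>
  Consistency turns the update direction into the projection of the error; this is the only way in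
  which \<open>b\<close> enters the convergence analysis.
\<close>

lemma reg_step_eq_reg_proj:
  assumes "A *v xstar = b"
  shows "reg_step A b lam S x = reg_proj A lam S *v (x - xstar)"
proof -
  have "restrict_rows A S *v x - restrict_vec b S = restrict_rows A S *v (x - xstar)"
    using assms[symmetric]
    by (simp add: restrict_rows_mult_vec matrix_vector_mult_diff_distrib restrict_vec_def vec_eq_iff)
  then show ?thesis by (simp add: reg_step_def reg_proj_def matrix_vector_mul_assoc)
qed

text \<open>
  A component of a solution in the null space could be dropped, which would shorten it.
\<close>

lemma min_norm_solution_in_row_space:
  fixes A :: "real^'n^'m"
  assumes "is_arg_min norm (\<lambda>y. A *v y = b) x"
  shows "x \<in> span (rows A)"
proof -
  obtain r n where r: "r \<in> span (rows A)" and n: "\<And>w. w \<in> span (rows A) \<Longrightarrow> orthogonal n w"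
    and x: "x = r + n"
    using orthogonal_subspace_decomp_exists[of "rows A" x] by metis
  have "(A *v n) \<bullet> (A *v n) = n \<bullet> (transpose A *v (A *v n))"
    by (metis inner_matrix_vector_mult inner_commute)
  also have "\<dots> = 0"
    using n[OF transpose_mult_vec_in_span_rows] by (simp add: orthogonal_def)
  finally have "A *v r = b"
    using assms x by (simp add: is_arg_min_def matrix_vector_right_distrib)
  then have "norm x \<le> norm r"
    using assms by (simp add: is_arg_min_linorder)
  moreover have "(norm x)\<^sup>2 = (norm r)\<^sup>2 + (norm n)\<^sup>2"
    unfolding x using n[OF r] by (intro norm_add_Pythagorean) (simp add: orthogonal_commute)
  ultimately have "n = 0"
    using power_mono[of "norm x" "norm r" 2] by simp
  then show ?thesis using r x by simp
qed

section \<open>The mean projection and the spectral constants\<close>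

lemma expectation_finite_pmf:
  fixes f :: "'k::finite \<Rightarrow> 'b::{banach, second_countable_topology}"
  shows "measure_pmf.expectation D f = (\<Sum>T\<in>UNIV. pmf D T *\<^sub>R f T)"
  by (rule integral_measure_pmf) auto

lemma expectation_finite_pmf_mult_vec:
  fixes X :: "'k::finite \<Rightarrow> real^'n^'m"
  shows "measure_pmf.expectation D X *v v = (\<Sum>T\<in>UNIV. pmf D T *\<^sub>R (X T *v v))"
proof -
  have "linear (\<lambda>Y::real^'n^'m. Y *v v)"
    by (rule linearI) (simp_all add: matrix_vector_mult_add_rdistrib scaleR_matrix_vector_assoc)
  then show ?thesis
    by (simp add: expectation_finite_pmf linear_sum[of "\<lambda>Y. Y *v v"] scaleR_matrix_vector_assoc)
qed

text \<open>
  Jensen's inequality for the squared norm, from nonnegativity of the variance.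
\<close>

lemma norm_square_mean_le:
  fixes D :: "'k::finite pmf" and y :: "'k \<Rightarrow> 'v::real_inner"
  defines "m \<equiv> (\<Sum>T\<in>UNIV. pmf D T *\<^sub>R y T)"
  shows "m \<bullet> m \<le> (\<Sum>T\<in>UNIV. pmf D T * (y T \<bullet> y T))"
proof -
  have "0 \<le> (\<Sum>T\<in>UNIV. pmf D T * ((y T - m) \<bullet> (y T - m)))"
    by (intro sum_nonneg mult_nonneg_nonneg) auto
  also have "\<dots> = (\<Sum>T\<in>UNIV. pmf D T * (y T \<bullet> y T) - 2 * ((pmf D T *\<^sub>R y T) \<bullet> m) + pmf D T * (m \<bullet> m))"
    by (intro sum.cong) (simp_all add: inner_diff_left inner_diff_right inner_commute algebra_simps)
  also have "\<dots> = (\<Sum>T\<in>UNIV. pmf D T * (y T \<bullet> y T)) - 2 * (m \<bullet> m) + (\<Sum>T\<in>UNIV. pmf D T) * (m \<bullet> m)"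
    by (simp only: sum.distrib sum_subtractf sum_distrib_left[symmetric] sum_distrib_right inner_sum_left[symmetric] m_def[symmetric])
  finally show ?thesis by (simp add: sum_pmf_eq_1)
qed

locale regularized_projections =
  fixes A :: "real^'n^'m" and lam :: real and D :: "'m set pmf"
  assumes lam_nonneg: "0 \<le> lam"
    and null_space: "{v. mean_reg_proj A lam D *v v = 0} = {v. A *v v = 0}"
begin

abbreviation "P \<equiv> reg_proj A lam"
abbreviation "Pbar \<equiv> mean_reg_proj A lam D"
abbreviation "second_moment \<equiv>
  measure_pmf.expectation D (\<lambda>T. whitened_proj A lam D T ** whitened_proj A lam D T)"
abbreviation "mu \<equiv> lambda_min_pos Pbar"
abbreviation "nu \<equiv> lambda_max second_moment"

lemma Pbar_mult_vec: "Pbar *v v = (\<Sum>T\<in>UNIV. pmf D T *\<^sub>R (P T *v v))"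
  unfolding mean_reg_proj_def by (rule expectation_finite_pmf_mult_vec)

lemma inner_Pbar: "x \<bullet> (Pbar *v y) = (\<Sum>T\<in>UNIV. pmf D T * (x \<bullet> (P T *v y)))"
  by (simp add: Pbar_mult_vec inner_sum_right)

lemma mean_norm_P_le: "(\<Sum>T\<in>UNIV. pmf D T * ((P T *v x) \<bullet> (P T *v x))) \<le> x \<bullet> (Pbar *v x)"
  unfolding inner_Pbar
  by (intro sum_mono mult_left_mono reg_proj_firmly_nonexpansive lam_nonneg) simp

lemma norm_Pbar_le: "(Pbar *v x) \<bullet> (Pbar *v x) \<le> x \<bullet> (Pbar *v x)"
  using norm_square_mean_le[of D "\<lambda>T. P T *v x"] mean_norm_P_le[of x] by (simp add: Pbar_mult_vec)

lemma psd_Pbar: "psd Pbar"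
  unfolding psd_def
proof (intro conjI allI)
  show "transpose Pbar = Pbar"
    by (rule symmetric_matrixI)
      (simp add: inner_Pbar inner_symmetric_matrix_swap[OF transpose_reg_proj[OF lam_nonneg]])
  show "0 \<le> v \<bullet> (Pbar *v v)" for v
    using norm_Pbar_le[of v] inner_ge_zero[of "Pbar *v v"] by linarith
qed

lemma transpose_Pbar: "transpose Pbar = Pbar"
  using psd_Pbar by (simp add: psd_def)

lemmas transpose_pinv_Pbar = transpose_pinv[OF transpose_Pbar]

lemma Pbar_in_row_space: "Pbar *v x \<in> span (rows A)"
  unfolding Pbar_mult_vec by (intro span_sum span_scale reg_proj_in_row_space)

text \<open>
  The hypothesis on the null space makes the range of the mean projection equal to the row space of
  \<open>A\<close>, so on the row space its pseudoinverse is a genuine inverse.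
\<close>

lemma Pbar_pinv_row_space:
  assumes "e \<in> span (rows A)"
  shows "Pbar *v (pinv Pbar *v e) = e" "pinv Pbar *v (Pbar *v e) = e"
proof -
  let ?d = "Pbar *v (pinv Pbar *v e) - e"
  have comm: "pinv Pbar *v (Pbar *v e) = Pbar *v (pinv Pbar *v e)"
    using pinv_commute[OF transpose_Pbar] by (simp add: matrix_vector_mul_assoc)
  have "Pbar *v ?d = (Pbar ** pinv Pbar ** Pbar) *v e - Pbar *v e"
    by (simp add: matrix_vector_mult_diff_distrib comm matrix_vector_mul_assoc[symmetric])
  then have "Pbar *v ?d = 0" by (simp add: mult_pinv_mult(1)[OF transpose_Pbar])
  then have "A *v ?d = 0" using null_space by blast
  moreover have "?d \<in> span (rows A)" using assms Pbar_in_row_space by (intro span_diff)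
  ultimately have "?d = 0" using nullspace_inter_rowspace by blast
  then show "Pbar *v (pinv Pbar *v e) = e" by simp
  with comm show "pinv Pbar *v (Pbar *v e) = e" by simp
qed

text \<open>
  The mean projection is at most the identity, so its pseudoinverse is at least the identity on the
  row space.
\<close>

lemma norm_le_pinv_Pbar:
  assumes "e \<in> span (rows A)" shows "e \<bullet> e \<le> e \<bullet> (pinv Pbar *v e)"
  using norm_Pbar_le[of "pinv Pbar *v e"] Pbar_pinv_row_space(1)[OF assms] by (simp add: inner_commute)

abbreviation "R \<equiv> psd_sqrt (pinv Pbar)"

lemma transpose_R: "transpose R = R" and R_R: "R *v (R *v x) = pinv Pbar *v x"
  using psd_sqrt[OF psd_pinv[OF psd_Pbar]] by (auto simp: psd_def matrix_vector_mul_assoc)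

lemma whitened_mult_vec: "whitened_proj A lam D T *v x = R *v (P T *v (R *v x))"
  by (simp add: whitened_proj_def matrix_vector_mul_assoc[symmetric])

lemma inner_second_moment:
  "x \<bullet> (second_moment *v y) =
     (\<Sum>T\<in>UNIV. pmf D T * ((P T *v (R *v x)) \<bullet> (pinv Pbar *v (P T *v (R *v y)))))"
proof -
  have "x \<bullet> ((whitened_proj A lam D T ** whitened_proj A lam D T) *v y)
      = (P T *v (R *v x)) \<bullet> (pinv Pbar *v (P T *v (R *v y)))" for T
    by (simp add: matrix_vector_mul_assoc[symmetric] whitened_mult_vec R_R
        inner_symmetric_matrix[OF transpose_R] inner_symmetric_matrix[OF transpose_reg_proj[OF lam_nonneg]])
  then show ?thesis by (simp add: expectation_finite_pmf_mult_vec inner_sum_right)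
qed

lemma transpose_second_moment: "transpose second_moment = second_moment"
  by (rule symmetric_matrixI)
    (simp add: inner_second_moment inner_symmetric_matrix_swap[OF transpose_pinv_Pbar])

text \<open>
  The vector \<open>R Pbar e\<close> is a preimage of \<open>e\<close> under the whitening map \<open>R\<close>: it transfers bounds on the
  whitened second moment to vectors of the row space.
\<close>

lemma row_space_R:
  assumes "e \<in> span (rows A)"
  shows "R *v (R *v (Pbar *v e)) = e" 
    "(R *v (Pbar *v e)) \<bullet> (R *v (Pbar *v e)) = e \<bullet> (Pbar *v e)"
proof -
  show *: "R *v (R *v (Pbar *v e)) = e"
    by (simp add: R_R Pbar_pinv_row_space(2)[OF assms])
  have "(R *v (Pbar *v e)) \<bullet> (R *v (Pbar *v e)) = (Pbar *v e) \<bullet> (R *v (R *v (Pbar *v e)))"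
    by (simp add: inner_symmetric_matrix[OF transpose_R])
  then show "(R *v (Pbar *v e)) \<bullet> (R *v (Pbar *v e)) = e \<bullet> (Pbar *v e)"
    by (simp add: * inner_commute)
qed

text \<open>
  This is what \<open>nu\<close> measures: the second moment of the projections in the norm of \<open>pinv Pbar\<close> exceeds
  the mean projection by at most the factor \<open>nu\<close>.
\<close>

lemma mean_pinv_norm_P_le:
  assumes "e \<in> span (rows A)"
  shows "(\<Sum>T\<in>UNIV. pmf D T * ((P T *v e) \<bullet> (pinv Pbar *v (P T *v e)))) \<le> nu * (e \<bullet> (Pbar *v e))"
  using inner_le_lambda_max[OF transpose_second_moment, of "R *v (Pbar *v e)"]
  unfolding inner_second_moment row_space_R[OF assms] .

lemma Pbar_nonzero: "A \<noteq> 0 \<Longrightarrow> Pbar \<noteq> 0"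
proof
  assume "A \<noteq> 0" "Pbar = 0"
  then have "A *v v = 0" for v using null_space by auto
  then have "A = 0" by (simp add: matrix_eq)
  with \<open>A \<noteq> 0\<close> show False by simp
qed

lemma mu_pos: "A \<noteq> 0 \<Longrightarrow> 0 < mu"
  using lambda_min_pos(1)[OF psd_Pbar Pbar_nonzero] .

text \<open>
  The whitened projections average to the identity on the row space, and by Jensen a second moment
  dominates the square of the mean.
\<close>

lemma nu_ge_1:
  assumes "A \<noteq> 0" shows "1 \<le> nu"
proof -
  obtain e where e: "e \<in> span (rows A)" "e \<noteq> 0"
  proof -
    obtain v where "Pbar *v v \<noteq> 0" using Pbar_nonzero[OF assms] by (auto simp: matrix_eq)
    then show ?thesis using that Pbar_in_row_space by blast
  qed
  let ?z = "R *v (Pbar *v e)"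
  have z: "?z \<noteq> 0" using row_space_R(1)[OF e(1)] e(2) by auto
  have "(\<Sum>T\<in>UNIV. pmf D T *\<^sub>R (R *v (P T *v e))) = ?z"
    by (simp add: Pbar_mult_vec linear_sum[OF matrix_vector_mul_linear] matrix_vector_mult_scaleR)
  then have "?z \<bullet> ?z \<le> (\<Sum>T\<in>UNIV. pmf D T * ((R *v (P T *v e)) \<bullet> (R *v (P T *v e))))"
    using norm_square_mean_le[of D "\<lambda>T. R *v (P T *v e)"] by simp
  also have "\<dots> = (\<Sum>T\<in>UNIV. pmf D T * ((P T *v e) \<bullet> (pinv Pbar *v (P T *v e))))"
    by (simp add: inner_symmetric_matrix[OF transpose_R, symmetric] R_R)
  also have "\<dots> \<le> nu * (?z \<bullet> ?z)"
    using mean_pinv_norm_P_le[OF e(1)] row_space_R(2)[OF e(1)] by simp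
  finally show ?thesis using z by simp
qed

text \<open>
  In the second moment, \<open>pinv Pbar\<close> is at most \<open>1 / mu\<close>, and the projections satisfy \<open>P\<^sup>2 \<le> P\<close>; what
  remains is \<open>1 / mu\<close> times the matrix \<open>R Pbar R\<close>, which is an orthogonal projection.
\<close>

lemma mu_nu_le_1:
  assumes "A \<noteq> 0" shows "mu * nu \<le> 1"
proof -
  obtain v where v: "v \<noteq> 0" "second_moment *v v = nu *\<^sub>R v"
    using lambda_max_eigenvalue[OF transpose_second_moment] by (auto simp: eigenvalues_def)
  let ?y = "R *v v"
  let ?q = "R *v (Pbar *v ?y)"
  have "nu * (v \<bullet> v) = (\<Sum>T\<in>UNIV. pmf D T * ((P T *v ?y) \<bullet> (pinv Pbar *v (P T *v ?y))))"
    using inner_second_moment[of v v] v by simp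
  also have "\<dots> \<le> (\<Sum>T\<in>UNIV. pmf D T * (((P T *v ?y) \<bullet> (P T *v ?y)) / mu))"
    by (intro sum_mono mult_left_mono pinv_inner_le psd_Pbar Pbar_nonzero assms) simp
  also have "\<dots> = (\<Sum>T\<in>UNIV. pmf D T * ((P T *v ?y) \<bullet> (P T *v ?y))) / mu"
    by (simp add: sum_divide_distrib)
  also have "\<dots> \<le> ?y \<bullet> (Pbar *v ?y) / mu"
    using mu_pos[OF assms] by (intro divide_right_mono mean_norm_P_le) simp
  finally have 1: "mu * nu * (v \<bullet> v) \<le> ?y \<bullet> (Pbar *v ?y)"
    using mu_pos[OF assms] by (simp add: field_simps)
  have yq: "?y \<bullet> (Pbar *v ?y) = v \<bullet> ?q" by (simp add: inner_symmetric_matrix[OF transpose_R])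
  have qq: "?q \<bullet> ?q = v \<bullet> ?q"
  proof -
    have "?q \<bullet> ?q = (Pbar *v ?y) \<bullet> (pinv Pbar *v (Pbar *v ?y))"
      by (simp add: inner_symmetric_matrix[OF transpose_R, symmetric] R_R)
    also have "\<dots> = ?y \<bullet> ((Pbar ** pinv Pbar ** Pbar) *v ?y)"
      by (simp add: inner_symmetric_matrix[OF transpose_Pbar] matrix_vector_mul_assoc[symmetric])
    finally show ?thesis using mult_pinv_mult(1)[OF transpose_Pbar] yq by simp
  qed
  have "0 \<le> (v - ?q) \<bullet> (v - ?q)" by simp
  also have "\<dots> = v \<bullet> v - v \<bullet> ?q"
    using qq by (simp add: inner_diff_left inner_diff_right inner_commute)
  finally have "mu * nu * (v \<bullet> v) \<le> 1 * (v \<bullet> v)" using 1 yq by simp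
  then show ?thesis using v(1) by (simp only: mult_le_cancel_right inner_gt_zero_iff inner_ge_zero) auto
qed

end

section \<open>Contraction of the potential\<close>

definition qform :: "real^'n^'n \<Rightarrow> real^'n \<Rightarrow> real" where
  "qform Q x = x \<bullet> (Q *v x)"

lemma qform_diff:
  assumes "transpose Q = Q"
  shows "qform Q (x - r *\<^sub>R y) = qform Q x - 2 * r * (x \<bullet> (Q *v y)) + r\<^sup>2 * qform Q y"
  using inner_symmetric_matrix_swap[OF assms, of x y]
  by (simp add: qform_def matrix_vector_mult_diff_distrib matrix_vector_mult_scaleR inner_diff_left
      inner_diff_right power2_eq_square algebra_simps)

lemma qform_scaleR: "qform Q (r *\<^sub>R x) = r\<^sup>2 * qform Q x"
  by (simp add: qform_def matrix_vector_mult_scaleR power2_eq_square)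

lemma qform_nonneg: "psd Q \<Longrightarrow> 0 \<le> qform Q x"
  by (simp add: qform_def psd_def)

text \<open>
  The defect in convexity is \<open>r (1 - r)\<close> times the form at \<open>x - y\<close>.
\<close>

lemma qform_convex:
  assumes "psd Q" "0 \<le> r" "r \<le> 1"
  shows "qform Q ((1 - r) *\<^sub>R x + r *\<^sub>R y) \<le> (1 - r) * qform Q x + r * qform Q y"
proof -
  have sym: "transpose Q = Q" using assms by (simp add: psd_def)
  have "(1 - r) * qform Q x + r * qform Q y - qform Q ((1 - r) *\<^sub>R x + r *\<^sub>R y)
      = r * (1 - r) * qform Q (x - y)"
    using inner_symmetric_matrix_swap[OF sym, of x y]
    by (simp add: qform_def matrix_vector_right_distrib matrix_vector_mult_diff_distrib
      matrix_vector_mult_scaleR inner_diff_left inner_diff_right inner_add_left inner_add_right algebra_simps)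
  moreover have "0 \<le> r * (1 - r) * qform Q (x - y)"
    using assms qform_nonneg[OF assms(1)] by simp
  ultimately show ?thesis by linarith
qed

lemma qform_young:
  assumes "psd Q" "0 < s"
  shows "qform Q (x - y) \<le> (1 + s) * qform Q x + (1 + 1 / s) * qform Q y"
proof -
  have sym: "transpose Q = Q" using assms by (simp add: psd_def)
  have "0 \<le> qform Q (s *\<^sub>R x - (- 1) *\<^sub>R y)" by (rule qform_nonneg[OF assms(1)])
  also have "\<dots> = s * (s * qform Q x + 2 * (x \<bullet> (Q *v y)) + qform Q y / s)"
    unfolding qform_diff[OF sym] qform_scaleR using assms(2) by (simp add: power2_eq_square algebra_simps)
  finally have "0 \<le> s * qform Q x + 2 * (x \<bullet> (Q *v y)) + qform Q y / s"
    using assms(2) by (simp add: zero_le_mult_iff)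
  then show ?thesis
    using qform_diff[OF sym, of x 1 y] by (simp add: algebra_simps)
qed

lemma psd_mat_1: "psd (mat 1 :: real^'n^'n)"
  by (simp add: psd_def)

lemma inner_young:
  fixes x y :: "real^'n"
  assumes "0 < s"
  shows "(x - y) \<bullet> (x - y) \<le> (1 + s) * (x \<bullet> x) + (1 + 1 / s) * (y \<bullet> y)"
  using qform_young[OF psd_mat_1 assms, of x y] by (simp add: qform_def)

locale momentum_parameters = regularized_projections A lam D
  for A :: "real^'n^'m" and lam :: real and D :: "'m set pmf" +
  fixes rho eta c :: real
  assumes A_nonzero: "A \<noteq> 0"
    and c: "0 < c" "c \<le> 1/2"
    and rho: "0 \<le> rho" "rho \<le> c * sqrt (mu / nu)"
    and eta: "c / nu \<le> eta" "eta \<le> 1 / (2 * nu)"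
begin

text \<open>
  The coefficient with which a projection step enters \<open>q = rho e + eta m\<close> under one update of the
  error \<open>e\<close> and the momentum \<open>m\<close>. In terms of it, the parameter ranges come
  down to \<open>rho \<le> eta \<le> gain \<le> 2 eta \<le> 1 / nu \<le> 1\<close> and \<open>rho\<^sup>2 / mu \<le> c eta \<le> gain\<close>.
\<close>

definition gain :: real where "gain = rho + (1 - rho) * eta"

lemma nu_pos: "0 < nu"
  using nu_ge_1[OF A_nonzero] by linarith

lemma rho_square_le: "rho\<^sup>2 / mu \<le> c\<^sup>2 / nu"
proof -
  have "rho\<^sup>2 \<le> (c * sqrt (mu / nu))\<^sup>2" using rho by (intro power_mono)
  also have "\<dots> = c\<^sup>2 * (mu / nu)"
    using mu_pos[OF A_nonzero] nu_pos by (simp add: power_mult_distrib)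
  finally show ?thesis using mu_pos[OF A_nonzero] nu_pos by (simp add: field_simps)
qed

lemma eta_pos: "0 < eta"
proof -
  have "0 < c / nu" using c nu_pos by simp
  then show ?thesis using eta by linarith
qed

lemma eta_le_half: "eta \<le> 1 / 2"
proof -
  have "1 / (2 * nu) \<le> 1 / 2" using nu_ge_1[OF A_nonzero] by (simp add: field_simps)
  then show ?thesis using eta by linarith
qed

text \<open>
  The chain is \<open>rho \<le> c sqrt (mu / nu) \<le> c / nu \<le> eta\<close>, where the middle step is \<open>mu nu \<le> 1\<close>.
\<close>

lemma rho_le_eta: "rho \<le> eta"
proof -
  have "mu / nu \<le> (1 / nu)\<^sup>2"
    using mu_nu_le_1[OF A_nonzero] nu_pos by (simp add: field_simps power2_eq_square)
  then have "sqrt (mu / nu) \<le> 1 / nu"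
    using nu_pos by (intro real_le_lsqrt) (auto intro: real_le_lsqrt)
  then have "c * sqrt (mu / nu) \<le> c * (1 / nu)" using c by (intro mult_left_mono) auto
  then show ?thesis using rho eta by simp
qed

lemma rho_le_half: "rho \<le> 1 / 2"
  using rho_le_eta eta_le_half by linarith

lemma eta_le_gain: "eta \<le> gain"
  using mult_nonneg_nonneg[of rho "1 - eta"] rho eta_le_half by (simp add: gain_def algebra_simps)

lemma gain_le_2_eta: "gain \<le> 2 * eta"
proof -
  have "0 \<le> rho * eta" using rho eta_pos by simp
  then show ?thesis using rho_le_eta by (simp add: gain_def algebra_simps)
qed

lemma gain_pos: "0 < gain"
  using eta_le_gain eta_pos by linarith

lemma gain_nu_le_1: "gain * nu \<le> 1"
proof -
  have "gain \<le> 1 / nu" using gain_le_2_eta eta by (simp add: field_simps)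
  then show ?thesis using nu_pos by (simp add: field_simps)
qed

lemma gain_le_1: "gain \<le> 1"
  using gain_le_2_eta eta_le_half by linarith

lemma c_square_le: "c\<^sup>2 / nu \<le> c * eta"
proof -
  have "c * (c / nu) \<le> c * eta" using c eta by (intro mult_left_mono) auto
  then show ?thesis by (simp add: power2_eq_square)
qed

lemma rho_square_le_gain: "rho\<^sup>2 / mu \<le> gain"
proof -
  have "c * eta \<le> 1 * eta" using c eta_pos by (intro mult_right_mono) auto
  then show ?thesis using rho_square_le c_square_le eta_le_gain by linarith
qed

text \<open>
  With \<open>q = rho e + eta m\<close> and \<open>u = e - eta m\<close>, the vector \<open>u\<close> is the error before the momentum was
  added, and \<open>q / rho\<close> is the error of the far-extrapolated point \<open>x + (eta / rho) m\<close> that drives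
  Nesterov-type schemes. Weighting by \<open>rho\<close> instead of dividing keeps the case \<open>rho = 0\<close> meaningful.
\<close>

definition energy :: "real^'n \<Rightarrow> real^'n \<Rightarrow> real" where
  "energy q u = qform (pinv Pbar) q + gain * (u \<bullet> u)"

definition potential :: "real^'n \<Rightarrow> real^'n \<Rightarrow> real" where
  "potential e m = energy (rho *\<^sub>R e + eta *\<^sub>R m) (e - eta *\<^sub>R m)"

text \<open>
  The value of the potential after a step with sample \<open>T\<close> that is computed without error. The update
  rules make the new \<open>u\<close> equal to \<open>e - P\<^sub>T e\<close> and the new \<open>q\<close> equal to
  \<open>(1 - rho) q + rho\<^sup>2 e - gain P\<^sub>T e\<close>.
\<close>

definition exact_potential :: "'m set \<Rightarrow> real^'n \<Rightarrow> real^'n \<Rightarrow> real" where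
  "exact_potential T e m =
     energy ((1 - rho) *\<^sub>R (rho *\<^sub>R e + eta *\<^sub>R m) + rho\<^sup>2 *\<^sub>R e - gain *\<^sub>R (P T *v e)) (e - P T *v e)"

lemma energy_nonneg: "0 \<le> energy q u"
  using gain_pos by (simp add: energy_def qform_nonneg[OF psd_pinv[OF psd_Pbar]])

lemma qform_pinv_le: "qform (pinv Pbar) x \<le> (x \<bullet> x) / mu"
  unfolding qform_def by (rule pinv_inner_le[OF psd_Pbar Pbar_nonzero[OF A_nonzero]])

text \<open>
  Let \<open>a = (1 - rho) q + rho\<^sup>2 e\<close>. Averaging over the sample turns the cross term
  \<open>a \<bullet> pinv Pbar (P\<^sub>T e)\<close> of the expanded square into \<open>a \<bullet> e\<close>. The second
  moment in the norm of \<open>pinv Pbar\<close> costs \<open>gain\<^sup>2 nu (e \<bullet> Pbar e)\<close>, which is paid for by the decrease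
  \<open>gain (e \<bullet> Pbar e)\<close> of the second part of the energy since \<open>gain nu \<le> 1\<close>. For the rest, convexity of
  the quadratic form yields the factor \<open>1 - rho\<close> on \<open>q\<close> at the price of \<open>rho\<^sup>3 |e|\<^sup>2 / mu\<close>, and
  \<open>q = (1 + rho) e - u\<close> yields it on \<open>u\<close> with \<open>rho gain |e|\<^sup>2\<close> to spare; the two balance by
  \<open>rho\<^sup>2 / mu \<le> gain\<close>.
\<close>

lemma mean_exact_potential_le:
  assumes e: "e \<in> span (rows A)"
  shows "(\<Sum>T\<in>UNIV. pmf D T * exact_potential T e m) \<le> (1 - rho) * potential e m"
proof -
  define q where "q = rho *\<^sub>R e + eta *\<^sub>R m"
  define u where "u = e - eta *\<^sub>R m"
  define a where "a = (1 - rho) *\<^sub>R q + rho\<^sup>2 *\<^sub>R e"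
  let ?Q = "pinv Pbar"
  have exact: "exact_potential T e m = (qform ?Q a + gain * (e \<bullet> e)) - 2 * gain * (a \<bullet> (?Q *v (P T *v e)))
      + gain\<^sup>2 * ((P T *v e) \<bullet> (?Q *v (P T *v e))) - 2 * gain * (e \<bullet> (P T *v e))
      + gain * ((P T *v e) \<bullet> (P T *v e))" for T
    unfolding exact_potential_def energy_def q_def[symmetric] a_def[symmetric] qform_diff[OF transpose_pinv_Pbar]
    by (simp add: qform_def inner_diff_left inner_diff_right inner_commute algebra_simps)
  have lin: "(\<Sum>T\<in>UNIV. pmf D T * (a \<bullet> (?Q *v (P T *v e)))) = a \<bullet> e"
  proof -
    have "(\<Sum>T\<in>UNIV. pmf D T * (a \<bullet> (?Q *v (P T *v e)))) = a \<bullet> (?Q *v (Pbar *v e))"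
      by (simp add: Pbar_mult_vec linear_sum[OF matrix_vector_mul_linear] matrix_vector_mult_scaleR inner_sum_right)
    then show ?thesis by (simp add: Pbar_pinv_row_space[OF e])
  qed
  have "(\<Sum>T\<in>UNIV. pmf D T * exact_potential T e m)
      = (\<Sum>T\<in>UNIV. pmf D T) * (qform ?Q a + gain * (e \<bullet> e))
        - 2 * gain * (\<Sum>T\<in>UNIV. pmf D T * (a \<bullet> (?Q *v (P T *v e))))
        + gain\<^sup>2 * (\<Sum>T\<in>UNIV. pmf D T * ((P T *v e) \<bullet> (?Q *v (P T *v e))))
        - 2 * gain * (\<Sum>T\<in>UNIV. pmf D T * (e \<bullet> (P T *v e)))
        + gain * (\<Sum>T\<in>UNIV. pmf D T * ((P T *v e) \<bullet> (P T *v e)))"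
    unfolding exact sum_distrib_left sum_distrib_right sum.distrib[symmetric] sum_subtractf[symmetric]
    by (intro sum.cong) (simp_all add: algebra_simps)
  also have "\<dots> \<le> qform ?Q a + gain * (e \<bullet> e) - 2 * gain * (a \<bullet> e)
      + gain\<^sup>2 * (nu * (e \<bullet> (Pbar *v e))) - 2 * gain * (e \<bullet> (Pbar *v e)) + gain * (e \<bullet> (Pbar *v e))"
    using gain_pos mean_pinv_norm_P_le[OF e] mean_norm_P_le[of e]
    unfolding lin inner_Pbar[symmetric] sum_pmf_eq_1[OF finite subset_UNIV]
    by (intro add_mono diff_mono mult_left_mono) auto
  also have "\<dots> = qform ?Q a + gain * (e \<bullet> e) - 2 * gain * (a \<bullet> e) - gain * ((1 - gain * nu) * (e \<bullet> (Pbar *v e)))"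
    by (simp add: algebra_simps power2_eq_square)
  also have "\<dots> \<le> qform ?Q a + gain * (e \<bullet> e) - 2 * gain * (a \<bullet> e)"
    using gain_pos gain_nu_le_1 psd_Pbar by (simp add: psd_def)
  finally have mean: "(\<Sum>T\<in>UNIV. pmf D T * exact_potential T e m)
      \<le> qform ?Q a + gain * (e \<bullet> e) - 2 * gain * (a \<bullet> e)" .
  have convex: "qform ?Q a \<le> (1 - rho) * qform ?Q q + rho * (rho\<^sup>2 * ((e \<bullet> e) / mu))"
  proof -
    have "a = (1 - rho) *\<^sub>R q + rho *\<^sub>R (rho *\<^sub>R e)" by (simp add: a_def power2_eq_square)
    then have "qform ?Q a \<le> (1 - rho) * qform ?Q q + rho * qform ?Q (rho *\<^sub>R e)"
      using qform_convex[OF psd_pinv[OF psd_Pbar], of rho q "rho *\<^sub>R e"] rho rho_le_half by simp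
    also have "qform ?Q (rho *\<^sub>R e) \<le> rho\<^sup>2 * ((e \<bullet> e) / mu)"
      unfolding qform_scaleR by (intro mult_left_mono qform_pinv_le) simp
    finally show ?thesis using rho by (simp add: mult_left_mono)
  qed
  have cross: "- (2 * gain * (a \<bullet> e)) \<le> - (2 * gain * (e \<bullet> e)) + gain * (1 - rho) * (u \<bullet> u + e \<bullet> e)"
  proof -
    have "q = (1 + rho) *\<^sub>R e - u" by (simp add: q_def u_def algebra_simps)
    then have qe: "q \<bullet> e = (1 + rho) * (e \<bullet> e) - u \<bullet> e" by (simp only: inner_diff_left inner_scaleR_left)
    have "a \<bullet> e = (1 - rho) * ((1 + rho) * (e \<bullet> e) - u \<bullet> e) + rho\<^sup>2 * (e \<bullet> e)"
      by (simp only: a_def inner_add_left inner_scaleR_left qe)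
    then have ae: "a \<bullet> e = (e \<bullet> e) - (1 - rho) * (u \<bullet> e)"
      by (simp add: algebra_simps power2_eq_square)
    have "0 \<le> gain * (1 - rho) * ((u - e) \<bullet> (u - e))" using gain_pos rho_le_half by simp
    then show ?thesis unfolding ae
      by (simp add: inner_diff_left inner_diff_right inner_commute algebra_simps)
  qed
  have "rho * (rho\<^sup>2 * ((e \<bullet> e) / mu)) \<le> rho * gain * (e \<bullet> e)"
  proof -
    have "rho * (rho\<^sup>2 / mu * (e \<bullet> e)) \<le> rho * (gain * (e \<bullet> e))"
      using rho by (intro mult_left_mono mult_right_mono rho_square_le_gain) auto
    then show ?thesis by simp
  qed
  with mean convex cross
  have "(\<Sum>T\<in>UNIV. pmf D T * exact_potential T e m) \<le> (1 - rho) * (qform ?Q q + gain * (u \<bullet> u))"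
    by (simp add: algebra_simps)
  then show ?thesis by (simp add: potential_def energy_def q_def u_def)
qed

text \<open>
  The error is recovered from \<open>q + u = (1 + rho) e\<close>.
\<close>

lemma norm_square_le_potential:
  assumes e: "e \<in> span (rows A)" and m: "m \<in> span (rows A)"
  shows "gain * (e \<bullet> e) \<le> 2 * potential e m"
proof -
  define q where "q = rho *\<^sub>R e + eta *\<^sub>R m"
  define u where "u = e - eta *\<^sub>R m"
  have "q \<in> span (rows A)" unfolding q_def using e m by (intro span_add span_scale)
  then have qq: "q \<bullet> q \<le> qform (pinv Pbar) q" unfolding qform_def by (rule norm_le_pinv_Pbar)
  have "q - (- 1) *\<^sub>R u = (1 + rho) *\<^sub>R e" by (simp add: q_def u_def algebra_simps)
  then have "(1 + rho)\<^sup>2 * (e \<bullet> e) = (q - (- 1) *\<^sub>R u) \<bullet> (q - (- 1) *\<^sub>R u)" 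
    by (simp only: inner_scaleR_left inner_scaleR_right power2_eq_square mult.assoc)
  also have "\<dots> \<le> 2 * (q \<bullet> q) + 2 * (u \<bullet> u)"
    using inner_young[of 1 q "(- 1) *\<^sub>R u"] by simp
  finally have "(1 + rho)\<^sup>2 * (e \<bullet> e) \<le> 2 * (q \<bullet> q) + 2 * (u \<bullet> u)" .
  moreover have "1 * (e \<bullet> e) \<le> (1 + rho)\<^sup>2 * (e \<bullet> e)"
    using rho by (intro mult_right_mono) (auto simp: one_le_power)
  ultimately have "gain * (e \<bullet> e) \<le> gain * (2 * (q \<bullet> q) + 2 * (u \<bullet> u))"
    using gain_pos by (intro mult_left_mono) auto
  moreover have "gain * (q \<bullet> q) \<le> 1 * qform (pinv Pbar) q"
    using qq gain_pos gain_le_1 by (intro mult_mono) auto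
  ultimately show ?thesis by (simp add: potential_def energy_def q_def u_def algebra_simps)
qed

lemma potential_initial_le: "potential e 0 \<le> 2 * gain * (e \<bullet> e)"
proof -
  have "rho\<^sup>2 * qform (pinv Pbar) e \<le> rho\<^sup>2 * ((e \<bullet> e) / mu)"
    by (intro mult_left_mono qform_pinv_le) simp
  also have "\<dots> = rho\<^sup>2 / mu * (e \<bullet> e)" by simp
  also have "\<dots> \<le> gain * (e \<bullet> e)" by (intro mult_right_mono rho_square_le_gain) simp
  finally show ?thesis by (simp add: potential_def energy_def qform_scaleR mult.commute)
qed

text \<open>
  The tolerance on the inexact step is calibrated for this bound: an error \<open>d\<close> in the step changes
  \<open>q\<close> by \<open>gain d\<close> and \<open>u\<close> by \<open>d\<close>, and the energy of this change must be of second order in \<open>rho\<close>,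
  because Young's inequality will multiply it by about \<open>4 / rho\<close>.
\<close>

lemma perturbation_energy_le:
  assumes e: "e \<in> span (rows A)" and m: "m \<in> span (rows A)"
    and d: "norm d \<le> rho\<^sup>2 / (8 * eta) * norm e"
  shows "energy (gain *\<^sub>R d) d \<le> rho\<^sup>2 / 16 * potential e m"
proof -
  have "d \<bullet> d \<le> (rho\<^sup>2 / (8 * eta))\<^sup>2 * (e \<bullet> e)"
    using power_mono[OF d, of 2] by (simp only: power_mult_distrib power2_norm_eq_inner norm_ge_zero)
  then have dd: "gain * (d \<bullet> d) \<le> (rho\<^sup>2 / (8 * eta))\<^sup>2 * (2 * potential e m)"
  proof -
    assume "d \<bullet> d \<le> (rho\<^sup>2 / (8 * eta))\<^sup>2 * (e \<bullet> e)"
    then have "gain * (d \<bullet> d) \<le> gain * ((rho\<^sup>2 / (8 * eta))\<^sup>2 * (e \<bullet> e))"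
      using gain_pos by (intro mult_left_mono) auto
    also have "\<dots> = (rho\<^sup>2 / (8 * eta))\<^sup>2 * (gain * (e \<bullet> e))" by simp
    also have "\<dots> \<le> (rho\<^sup>2 / (8 * eta))\<^sup>2 * (2 * potential e m)"
      by (intro mult_left_mono norm_square_le_potential e m) simp
    finally show ?thesis .
  qed
  have "energy (gain *\<^sub>R d) d \<le> gain\<^sup>2 * ((d \<bullet> d) / mu) + gain * (d \<bullet> d)"
    unfolding energy_def qform_scaleR using gain_pos by (intro add_mono mult_left_mono qform_pinv_le) auto
  also have "\<dots> = (gain / mu + 1) * (gain * (d \<bullet> d))" by (simp add: power2_eq_square algebra_simps)
  also have "\<dots> \<le> (gain / mu + 1) * ((rho\<^sup>2 / (8 * eta))\<^sup>2 * (2 * potential e m))"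
    using less_imp_le[OF gain_pos] less_imp_le[OF mu_pos[OF A_nonzero]] by (intro mult_left_mono dd) simp
  also have "\<dots> = ((gain / mu + 1) * (rho\<^sup>2 / eta\<^sup>2)) * (rho\<^sup>2 / 32 * potential e m)"
    by (simp add: power2_eq_square field_simps)
  also have "\<dots> \<le> 2 * (rho\<^sup>2 / 32 * potential e m)"
  proof (rule mult_right_mono)
    have "gain / mu * (rho\<^sup>2 / eta\<^sup>2) \<le> 2 * eta / mu * (rho\<^sup>2 / eta\<^sup>2)"
      using gain_le_2_eta mu_pos[OF A_nonzero] by (intro mult_right_mono divide_right_mono) auto
    also have "\<dots> = 2 * (rho\<^sup>2 / mu) / eta" using eta_pos by (simp add: power2_eq_square field_simps)
    also have "\<dots> \<le> 2 * (c * eta) / eta"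
      using rho_square_le c_square_le eta_pos by (intro divide_right_mono mult_left_mono) auto
    also have "\<dots> \<le> 1" using c eta_pos by simp
    finally have 1: "gain / mu * (rho\<^sup>2 / eta\<^sup>2) \<le> 1" .
    have "rho\<^sup>2 \<le> eta\<^sup>2" using rho rho_le_eta by (intro power_mono)
    then have "rho\<^sup>2 / eta\<^sup>2 \<le> 1" using eta_pos by simp
    with 1 show "(gain / mu + 1) * (rho\<^sup>2 / eta\<^sup>2) \<le> 2" unfolding distrib_right by linarith
    show "0 \<le> rho\<^sup>2 / 32 * potential e m" by (simp add: potential_def energy_nonneg)
  qed
  finally show ?thesis by simp
qed

lemma energy_diff_le:
  assumes "0 < s"
  shows "energy (q - q') (u - u') \<le> (1 + s) * energy q u + (1 + 1 / s) * energy q' u'"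
proof -
  have "gain * ((u - u') \<bullet> (u - u')) \<le> gain * ((1 + s) * (u \<bullet> u) + (1 + 1 / s) * (u' \<bullet> u'))"
    using gain_pos by (intro mult_left_mono inner_young assms) simp
  with qform_young[OF psd_pinv[OF psd_Pbar] assms, of q q'] show ?thesis
    by (simp add: energy_def algebra_simps)
qed

text \<open>
  Young's inequality with parameter \<open>rho / 4\<close> separates the exact step from the perturbation. For
  \<open>rho = 0\<close> the tolerance forces the step to be exact.
\<close>

lemma inexact_step:
  assumes e: "e \<in> span (rows A)" and m: "m \<in> span (rows A)"
    and w: "norm (w - P T *v e) \<le> rho\<^sup>2 / (8 * eta) * norm e"
    and m': "m' = ((1 - rho) / (1 + rho)) *\<^sub>R (m - w)"
    and e': "e' = e - w + eta *\<^sub>R m'"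
  shows "potential e' m' \<le> (1 + rho / 4) * exact_potential T e m + (rho / 4 + rho\<^sup>2 / 16) * potential e m"
proof -
  define d where "d = w - P T *v e"
  let ?q = "(1 - rho) *\<^sub>R (rho *\<^sub>R e + eta *\<^sub>R m) + rho\<^sup>2 *\<^sub>R e - gain *\<^sub>R (P T *v e)"
  let ?u = "e - P T *v e"
  have wd: "w = P T *v e + d" by (simp add: d_def)
  have "(1 + rho) *\<^sub>R m' = (1 - rho) *\<^sub>R (m - w)" using m' rho by simp
  then have m1: "(eta * (1 + rho)) *\<^sub>R m' = (eta * (1 - rho)) *\<^sub>R (m - w)"
    by (metis scaleR_scaleR)
  have "rho *\<^sub>R e' + eta *\<^sub>R m' = rho *\<^sub>R (e - w) + (eta * (1 + rho)) *\<^sub>R m'"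
    by (simp add: e' algebra_simps)
  also have "\<dots> = ?q - gain *\<^sub>R d"
    unfolding m1 wd by (simp add: gain_def power2_eq_square algebra_simps)
  finally have q': "rho *\<^sub>R e' + eta *\<^sub>R m' = ?q - gain *\<^sub>R d" .
  have u': "e' - eta *\<^sub>R m' = ?u - d" by (simp add: e' wd)
  have pot': "potential e' m' = energy (?q - gain *\<^sub>R d) (?u - d)"
    unfolding potential_def q' u' ..
  show ?thesis
  proof (cases "rho = 0")
    case True
    then have "d = 0" using w by (simp add: d_def)
    then have "potential e' m' = exact_potential T e m" unfolding pot' exact_potential_def by simp
    moreover have "0 \<le> rho / 4 * exact_potential T e m" "0 \<le> (rho / 4 + rho\<^sup>2 / 16) * potential e m"
      using rho by (simp_all add: exact_potential_def potential_def energy_nonneg)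
    ultimately show ?thesis by (simp add: distrib_right)
  next
    case False
    then have "0 < rho / 4" using rho by simp
    from energy_diff_le[OF this, of ?q "gain *\<^sub>R d" ?u d]
    have "potential e' m' \<le> (1 + rho / 4) * exact_potential T e m + (1 + 4 / rho) * energy (gain *\<^sub>R d) d"
      unfolding pot' exact_potential_def by simp
    also have "(1 + 4 / rho) * energy (gain *\<^sub>R d) d \<le> (1 + 4 / rho) * (rho\<^sup>2 / 16 * potential e m)"
      using rho w by (intro mult_left_mono perturbation_energy_le e m) (auto simp: d_def)
    also have "\<dots> = (rho / 4 + rho\<^sup>2 / 16) * potential e m"
      using False by (simp add: field_simps power2_eq_square)
    finally show ?thesis by simp
  qed
qed

end

section \<open>Independent samples and the expected decay\<close>

lemma borel_measurable_matrix_vector_mult: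
  fixes X :: "real^'n^'m"
  assumes "f \<in> borel_measurable M" shows "(\<lambda>\<omega>. X *v f \<omega>) \<in> borel_measurable M"
proof -
  have "continuous_on UNIV ((*v) X)" by (intro linear_continuous_on matrix_vector_mul_bounded_linear)
  then show ?thesis using assms borel_measurable_continuous_on[of "(*v) X" f M] by simp
qed

text \<open>
  An event independent of a \<open>\<sigma>\<close>-algebra factors out of integrals of functions measurable for it:
  true by hypothesis for indicators, and preserved by the constructions that generate all
  nonnegative measurable functions.
\<close>

lemma nn_integral_indicator_independent:
  assumes sub: "subalgebra M F" and A: "A \<in> sets M"
    and indep: "\<And>B. B \<in> sets F \<Longrightarrow> emeasure M (A \<inter> B) = emeasure M A * emeasure M B"
    and f: "f \<in> borel_measurable F"
  shows "(\<integral>\<^sup>+\<omega>. indicator A \<omega> * f \<omega> \<partial>M) = emeasure M A * (\<integral>\<^sup>+\<omega>. f \<omega> \<partial>M)"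
  using f
proof (induction rule: borel_measurable_induct)
  case (cong f g)
  have fg: "f \<omega> = g \<omega>" if "\<omega> \<in> space M" for \<omega>
    using cong(3) sub that by (simp add: subalgebra_def)
  have eq: "(\<integral>\<^sup>+\<omega>. indicator A \<omega> * f \<omega> \<partial>M) = (\<integral>\<^sup>+\<omega>. indicator A \<omega> * g \<omega> \<partial>M)"
    "(\<integral>\<^sup>+\<omega>. f \<omega> \<partial>M) = (\<integral>\<^sup>+\<omega>. g \<omega> \<partial>M)"
    by (rule nn_integral_cong, simp add: fg)+
  show ?case unfolding eq by (rule cong(4))
next
  case (set B)
  then have B: "B \<in> sets M" using sub by (auto simp: subalgebra_def)
  have "(\<integral>\<^sup>+\<omega>. indicator A \<omega> * indicator B \<omega> \<partial>M) = (\<integral>\<^sup>+\<omega>. indicator (A \<inter> B) \<omega> \<partial>M)"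
    by (intro nn_integral_cong) (simp add: indicator_inter_arith)
  then show ?case using indep[OF set] A B by simp
next
  case (mult u c)
  have [measurable]: "u \<in> borel_measurable M" "A \<in> sets M"
    using measurable_from_subalg[OF sub] mult A by auto
  have "(\<integral>\<^sup>+\<omega>. indicator A \<omega> * (c * u \<omega>) \<partial>M) = c * (\<integral>\<^sup>+\<omega>. indicator A \<omega> * u \<omega> \<partial>M)"
    by (subst nn_integral_cmult[symmetric]) (auto simp: mult_ac)
  then show ?case using mult by (simp add: nn_integral_cmult mult_ac)
next
  case (add u v)
  have [measurable]: "u \<in> borel_measurable M" "v \<in> borel_measurable M" "A \<in> sets M"
    using measurable_from_subalg[OF sub] add A by auto
  have "(\<integral>\<^sup>+\<omega>. indicator A \<omega> * (v \<omega> + u \<omega>) \<partial>M)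
      = (\<integral>\<^sup>+\<omega>. indicator A \<omega> * v \<omega> \<partial>M) + (\<integral>\<^sup>+\<omega>. indicator A \<omega> * u \<omega> \<partial>M)"
    by (subst nn_integral_add[symmetric]) (auto simp: distrib_left)
  then show ?case using add by (simp add: nn_integral_add distrib_left)
next
  case (seq U)
  have [measurable]: "U i \<in> borel_measurable M" "A \<in> sets M" for i
    using measurable_from_subalg[OF sub] seq A by auto
  have inc: "incseq (\<lambda>i \<omega>. indicator A \<omega> * U i \<omega>)"
    using \<open>incseq U\<close> by (auto simp: incseq_def le_fun_def intro!: mult_left_mono)
  have "(\<integral>\<^sup>+\<omega>. indicator A \<omega> * (SUP i. U i) \<omega> \<partial>M) = (\<integral>\<^sup>+\<omega>. (SUP i. indicator A \<omega> * U i \<omega>) \<partial>M)"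
    by (simp add: SUP_mult_left_ennreal image_comp)
  also have "\<dots> = (SUP i. \<integral>\<^sup>+\<omega>. indicator A \<omega> * U i \<omega> \<partial>M)"
    by (intro nn_integral_monotone_convergence_SUP inc) measurable
  also have "\<dots> = (SUP i. emeasure M A * (\<integral>\<^sup>+\<omega>. U i \<omega> \<partial>M))" using seq by simp
  also have "\<dots> = emeasure M A * (SUP i. \<integral>\<^sup>+\<omega>. U i \<omega> \<partial>M)"
    by (simp add: SUP_mult_left_ennreal)
  also have "(SUP i. \<integral>\<^sup>+\<omega>. U i \<omega> \<partial>M) = (\<integral>\<^sup>+\<omega>. (SUP i. U i) \<omega> \<partial>M)"
    using nn_integral_monotone_convergence_SUP[OF \<open>incseq U\<close>] by (simp add: image_comp)
  finally show ?case .
qed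

text \<open>
  A sample with finitely many values, independent of the past \<open>F\<close>, may be averaged first with the past
  held fixed. Working with nonnegative integrals makes integrability of the iterates a consequence of
  the final bound instead of a prerequisite.
\<close>

lemma (in prob_space) nn_integral_independent_sample:
  fixes D :: "'k::finite pmf" and f :: "'k \<Rightarrow> 'a \<Rightarrow> ennreal"
  assumes sub: "subalgebra M F" and S: "S \<in> M \<rightarrow>\<^sub>M count_space UNIV"
    and distr: "distr M (count_space UNIV) S = measure_pmf D"
    and indep: "indep_set {S -` X \<inter> space M | X. True} (sets F)"
    and f: "\<And>k. f k \<in> borel_measurable F"
  shows "(\<integral>\<^sup>+\<omega>. f (S \<omega>) \<omega> \<partial>M) = (\<Sum>k\<in>UNIV. ennreal (pmf D k) * (\<integral>\<^sup>+\<omega>. f k \<omega> \<partial>M))"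
proof -
  define E where "E k = S -` {k} \<inter> space M" for k
  have E[measurable]: "E k \<in> sets M" for k unfolding E_def using S by (rule measurable_sets) simp
  have [measurable]: "f k \<in> borel_measurable M" for k by (rule measurable_from_subalg[OF sub f])
  have prob_E: "emeasure M (E k) = ennreal (pmf D k)" for k
    using emeasure_distr[OF S, of "{k}"] unfolding distr E_def by (simp add: emeasure_pmf_single)
  have ind: "emeasure M (E k \<inter> B) = emeasure M (E k) * emeasure M B" if "B \<in> sets F" for k B
  proof -
    have "prob (E k \<inter> B) = prob (E k) * prob B"
      by (rule indep_setD[OF indep _ that]) (auto simp: E_def)
    then show ?thesis by (simp add: emeasure_eq_measure ennreal_mult)
  qed
  have "(\<integral>\<^sup>+\<omega>. f (S \<omega>) \<omega> \<partial>M) = (\<integral>\<^sup>+\<omega>. (\<Sum>k\<in>UNIV. indicator (E k) \<omega> * f k \<omega>) \<partial>M)"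
  proof (rule nn_integral_cong)
    fix \<omega> assume "\<omega> \<in> space M"
    then have "(\<Sum>k\<in>UNIV. indicator (E k) \<omega> * f k \<omega>) = (\<Sum>k\<in>UNIV. if S \<omega> = k then f k \<omega> else 0)"
      by (intro sum.cong) (auto simp: E_def)
    then show "f (S \<omega>) \<omega> = (\<Sum>k\<in>UNIV. indicator (E k) \<omega> * f k \<omega>)" by simp
  qed
  also have "\<dots> = (\<Sum>k\<in>UNIV. \<integral>\<^sup>+\<omega>. indicator (E k) \<omega> * f k \<omega> \<partial>M)"
    by (rule nn_integral_sum) measurable
  also have "\<dots> = (\<Sum>k\<in>UNIV. ennreal (pmf D k) * (\<integral>\<^sup>+\<omega>. f k \<omega> \<partial>M))"
    by (simp add: nn_integral_indicator_independent[OF sub E ind f] prob_E)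
  finally show ?thesis .
qed

context momentum_parameters
begin

lemma measurable_potential:
  assumes [measurable]: "e \<in> borel_measurable M" "m \<in> borel_measurable M"
  shows "(\<lambda>\<omega>. potential (e \<omega>) (m \<omega>)) \<in> borel_measurable M"
    "(\<lambda>\<omega>. exact_potential T (e \<omega>) (m \<omega>)) \<in> borel_measurable M"
proof -
  note [measurable] = borel_measurable_matrix_vector_mult
  show "(\<lambda>\<omega>. potential (e \<omega>) (m \<omega>)) \<in> borel_measurable M"
    "(\<lambda>\<omega>. exact_potential T (e \<omega>) (m \<omega>)) \<in> borel_measurable M"
    unfolding potential_def exact_potential_def energy_def qform_def by measurable
qed

lemma potential_nonneg: "0 \<le> potential e m" and exact_potential_nonneg: "0 \<le> exact_potential T e m"
  by (simp_all add: potential_def exact_potential_def energy_nonneg)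

text \<open>
  The factor \<open>1 - rho\<close> of an exact step, inflated by Young's inequality and increased by the
  perturbation.
\<close>

lemma contraction_factor_le: "(1 + rho / 4) * (1 - rho) + (rho / 4 + rho\<^sup>2 / 16) \<le> 1 - rho / 2"
proof -
  have "(1 + rho / 4) * (1 - rho) + (rho / 4 + rho\<^sup>2 / 16) = 1 - rho / 2 - 3 / 16 * rho\<^sup>2"
    by (simp add: power2_eq_square field_simps)
  then show ?thesis by simp
qed

lemma expected_potential_step:
  assumes M: "prob_space M" and sub: "subalgebra M F"
    and S: "S \<in> M \<rightarrow>\<^sub>M count_space UNIV"
    and distr: "distr M (count_space UNIV) S = measure_pmf D"
    and indep: "prob_space.indep_set M {S -` X \<inter> space M | X. True} (sets F)"
    and e: "e \<in> borel_measurable F" and m: "m \<in> borel_measurable F"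
    and e_row: "AE \<omega> in M. e \<omega> \<in> span (rows A)" and m_row: "AE \<omega> in M. m \<omega> \<in> span (rows A)"
    and w: "AE \<omega> in M. norm (w \<omega> - P (S \<omega>) *v e \<omega>) \<le> rho\<^sup>2 / (8 * eta) * norm (e \<omega>)"
    and m': "AE \<omega> in M. m' \<omega> = ((1 - rho) / (1 + rho)) *\<^sub>R (m \<omega> - w \<omega>)"
    and e': "AE \<omega> in M. e' \<omega> = e \<omega> - w \<omega> + eta *\<^sub>R m' \<omega>"
  shows "(\<integral>\<^sup>+\<omega>. potential (e' \<omega>) (m' \<omega>) \<partial>M)
    \<le> ennreal (1 - rho / 2) * (\<integral>\<^sup>+\<omega>. potential (e \<omega>) (m \<omega>) \<partial>M)"
proof -
  interpret prob_space M by fact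
  let ?a = "1 + rho / 4" and ?b = "rho / 4 + rho\<^sup>2 / 16"
  note meas = measurable_potential[OF e m]
  note [measurable] = measurable_from_subalg[OF sub meas(1)] measurable_from_subalg[OF sub meas(2)]
  have [measurable]: "(\<lambda>\<omega>. exact_potential (S \<omega>) (e \<omega>) (m \<omega>)) \<in> borel_measurable M"
    by (rule measurable_compose_countable'[where I=UNIV, OF _ S]) auto
  have "(\<integral>\<^sup>+\<omega>. exact_potential (S \<omega>) (e \<omega>) (m \<omega>) \<partial>M)
      = (\<Sum>T\<in>UNIV. ennreal (pmf D T) * (\<integral>\<^sup>+\<omega>. exact_potential T (e \<omega>) (m \<omega>) \<partial>M))"
    using meas(2) by (intro nn_integral_independent_sample[OF sub S distr indep,
          where f = "\<lambda>T \<omega>. ennreal (exact_potential T (e \<omega>) (m \<omega>))"]) simp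
  also have "\<dots> = (\<integral>\<^sup>+\<omega>. (\<Sum>T\<in>UNIV. ennreal (pmf D T) * exact_potential T (e \<omega>) (m \<omega>)) \<partial>M)"
    by (simp add: nn_integral_sum nn_integral_cmult)
  also have "\<dots> \<le> (\<integral>\<^sup>+\<omega>. ennreal (1 - rho) * potential (e \<omega>) (m \<omega>) \<partial>M)"
  proof (rule nn_integral_mono_AE)
    show "AE \<omega> in M. (\<Sum>T\<in>UNIV. ennreal (pmf D T) * exact_potential T (e \<omega>) (m \<omega>))
        \<le> ennreal (1 - rho) * potential (e \<omega>) (m \<omega>)"
      using e_row m_row
    proof eventually_elim
      case (elim \<omega>)
      have "(\<Sum>T\<in>UNIV. ennreal (pmf D T) * ennreal (exact_potential T (e \<omega>) (m \<omega>)))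
          = ennreal (\<Sum>T\<in>UNIV. pmf D T * exact_potential T (e \<omega>) (m \<omega>))"
        by (simp add: ennreal_mult[symmetric] exact_potential_nonneg sum_ennreal)
      also have "\<dots> \<le> ennreal ((1 - rho) * potential (e \<omega>) (m \<omega>))"
        by (intro ennreal_leI mean_exact_potential_le elim)
      finally show ?case using rho_le_half by (simp add: ennreal_mult potential_nonneg)
    qed
  qed
  also have "\<dots> = ennreal (1 - rho) * (\<integral>\<^sup>+\<omega>. potential (e \<omega>) (m \<omega>) \<partial>M)"
    by (simp add: nn_integral_cmult)
  finally have exact: "(\<integral>\<^sup>+\<omega>. exact_potential (S \<omega>) (e \<omega>) (m \<omega>) \<partial>M)
      \<le> ennreal (1 - rho) * (\<integral>\<^sup>+\<omega>. potential (e \<omega>) (m \<omega>) \<partial>M)" .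
  have "(\<integral>\<^sup>+\<omega>. potential (e' \<omega>) (m' \<omega>) \<partial>M)
      \<le> (\<integral>\<^sup>+\<omega>. ennreal ?a * exact_potential (S \<omega>) (e \<omega>) (m \<omega>) + ennreal ?b * potential (e \<omega>) (m \<omega>) \<partial>M)"
  proof (rule nn_integral_mono_AE)
    show "AE \<omega> in M. ennreal (potential (e' \<omega>) (m' \<omega>))
        \<le> ennreal ?a * exact_potential (S \<omega>) (e \<omega>) (m \<omega>) + ennreal ?b * potential (e \<omega>) (m \<omega>)"
      using e_row m_row w m' e'
    proof eventually_elim
      case (elim \<omega>)
      have "potential (e' \<omega>) (m' \<omega>)
          \<le> ?a * exact_potential (S \<omega>) (e \<omega>) (m \<omega>) + ?b * potential (e \<omega>) (m \<omega>)"
        by (rule inexact_step[OF elim])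
      then show ?case
        using rho by (simp add: ennreal_mult[symmetric] ennreal_plus[symmetric] potential_nonneg
            exact_potential_nonneg ennreal_leI del: ennreal_plus)
    qed
  qed
  also have "\<dots> = ennreal ?a * (\<integral>\<^sup>+\<omega>. exact_potential (S \<omega>) (e \<omega>) (m \<omega>) \<partial>M)
      + ennreal ?b * (\<integral>\<^sup>+\<omega>. potential (e \<omega>) (m \<omega>) \<partial>M)"
    by (simp add: nn_integral_add nn_integral_cmult)
  also have "\<dots> \<le> ennreal ?a * (ennreal (1 - rho) * (\<integral>\<^sup>+\<omega>. potential (e \<omega>) (m \<omega>) \<partial>M))
      + ennreal ?b * (\<integral>\<^sup>+\<omega>. potential (e \<omega>) (m \<omega>) \<partial>M)"
    by (intro add_right_mono mult_left_mono exact) simp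
  also have "\<dots> = ennreal (?a * (1 - rho) + ?b) * (\<integral>\<^sup>+\<omega>. potential (e \<omega>) (m \<omega>) \<partial>M)"
  proof -
    have "ennreal (?a * (1 - rho) + ?b) = ennreal ?a * ennreal (1 - rho) + ennreal ?b"
      using rho rho_le_half by (subst ennreal_plus) (auto simp: ennreal_mult)
    then show ?thesis by (simp only: distrib_right mult.assoc)
  qed
  also have "\<dots> \<le> ennreal (1 - rho / 2) * (\<integral>\<^sup>+\<omega>. potential (e \<omega>) (m \<omega>) \<partial>M)"
    by (intro mult_right_mono ennreal_leI contraction_factor_le) simp
  finally show ?thesis .
qed

end

theorem theorem2p1:
  fixes A :: "real^'n^'m" and b :: "real^'m" and xstar x0 :: "real^'n"
    and D :: "'m set pmf"
    and lam mu nu rhobar rho eta c :: real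
    and M :: "'a measure" and F :: "nat \<Rightarrow> 'a measure"
    and S :: "nat \<Rightarrow> 'a \<Rightarrow> 'm set"
    and x mom wt :: "nat \<Rightarrow> 'a \<Rightarrow> real^'n"
  assumes consistent: "\<exists>y. A *v y = b"
    and xstar: "is_arg_min norm (\<lambda>y. A *v y = b) xstar"
    and lam: "0 \<le> lam"
    and null_space: "{v. mean_reg_proj A lam D *v v = 0} = {v. A *v v = 0}"
    and mu: "mu = lambda_min_pos (mean_reg_proj A lam D)"
    and nu: "nu = lambda_max (measure_pmf.expectation D
                    (\<lambda>T. whitened_proj A lam D T ** whitened_proj A lam D T))"
    and rhobar: "rhobar = sqrt (mu / nu)"
    and c: "0 < c" "c \<le> 1/2"
    and rho: "rho \<in> {0..c * rhobar}"
    and eta: "eta \<in> {c / nu..1 / (2 * nu)}"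
    \<comment> \<open>\<open>F t\<close> is the history before step \<open>t\<close>; it contains all randomness of earlier steps,
      including any used to compute the inexact steps, and the sample \<open>S t\<close> is independent of it\<close>
    and prob_space: "prob_space M"
    and filtration: "filtration (space M) F" "\<And>t. subalgebra M (F t)"
    and S_adapted: "\<And>t. S t \<in> F (Suc t) \<rightarrow>\<^sub>M count_space UNIV"
    and wt_adapted: "\<And>t. wt t \<in> F (Suc t) \<rightarrow>\<^sub>M borel"
    and S_distr: "\<And>t. distr M (count_space UNIV) (S t) = measure_pmf D"
    and S_indep: "\<And>t. prob_space.indep_set M {S t -` X \<inter> space M | X. True} (sets (F t))"
    \<comment> \<open>automatic if \<open>A\<close> has full column rank; otherwise a component of \<open>x t\<close> in the
      null space of \<open>A\<close> would never be corrected\<close>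
    and x0_row_space: "x0 \<in> span (rows A)"
    and wt_row_space: "\<And>t. AE \<omega> in M. wt t \<omega> \<in> span (rows A)"
    and inexact: "\<And>t. AE \<omega> in M. norm (wt t \<omega> - reg_step A b lam (S t \<omega>) (x t \<omega>))
                      \<le> rho\<^sup>2 / (8 * eta) * norm (x t \<omega> - xstar)"
    and x_0: "\<And>\<omega>. \<omega> \<in> space M \<Longrightarrow> x 0 \<omega> = x0"
    and mom_0: "\<And>\<omega>. \<omega> \<in> space M \<Longrightarrow> mom 0 \<omega> = 0"
    and mom_Suc: "\<And>t \<omega>. \<omega> \<in> space M \<Longrightarrow>
                    mom (Suc t) \<omega> = ((1 - rho) / (1 + rho)) *\<^sub>R (mom t \<omega> - wt t \<omega>)"
    and x_Suc: "\<And>t \<omega>. \<omega> \<in> space M \<Longrightarrow>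
                    x (Suc t) \<omega> = x t \<omega> - wt t \<omega> + eta *\<^sub>R mom (Suc t) \<omega>"
  shows "prob_space.expectation M (\<lambda>\<omega>. (norm (x t \<omega> - xstar))\<^sup>2)
           \<le> 8 * (1 - rho / 2) ^ t * (norm (x0 - xstar))\<^sup>2"
proof -
  let ?V = "span (rows A)"
  interpret prob_space M by fact
  interpret filtration "space M" F by fact
  define e where "e t \<omega> = x t \<omega> - xstar" for t \<omega>
  have Axstar: "A *v xstar = b" using xstar by (simp add: is_arg_min_def)
  have xstar_row: "xstar \<in> ?V" by (rule min_norm_solution_in_row_space[OF xstar])
  have space_eq: "space (F t) = space M" for t by (rule space_F)
  have meas: "x t \<in> borel_measurable (F t) \<and> mom t \<in> borel_measurable (F t)" for t
  proof (induction t)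
    case 0
    have "x 0 \<in> borel_measurable (F 0) \<longleftrightarrow> (\<lambda>_. x0) \<in> borel_measurable (F 0)"
      by (rule measurable_cong) (simp add: space_eq x_0)
    moreover have "mom 0 \<in> borel_measurable (F 0) \<longleftrightarrow> (\<lambda>_. 0 :: real^'n) \<in> borel_measurable (F 0)"
      by (rule measurable_cong) (simp add: space_eq mom_0)
    ultimately show ?case by simp
  next
    case (Suc t)
    have "subalgebra (F (Suc t)) (F t)"
      using sets_F_mono[of t "Suc t"] by (simp add: subalgebra_def space_eq)
    then have [measurable]: "x t \<in> borel_measurable (F (Suc t))" "mom t \<in> borel_measurable (F (Suc t))"
      "wt t \<in> borel_measurable (F (Suc t))"
      using Suc measurable_from_subalg wt_adapted by auto
    have mom: "mom (Suc t) \<in> borel_measurable (F (Suc t)) \<longleftrightarrow>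
        (\<lambda>\<omega>. ((1 - rho) / (1 + rho)) *\<^sub>R (mom t \<omega> - wt t \<omega>)) \<in> borel_measurable (F (Suc t))"
      by (rule measurable_cong) (simp add: space_eq mom_Suc)
    then have [measurable]: "mom (Suc t) \<in> borel_measurable (F (Suc t))" by simp
    have "x (Suc t) \<in> borel_measurable (F (Suc t)) \<longleftrightarrow>
        (\<lambda>\<omega>. x t \<omega> - wt t \<omega> + eta *\<^sub>R mom (Suc t) \<omega>) \<in> borel_measurable (F (Suc t))"
      by (rule measurable_cong) (simp add: space_eq x_Suc)
    then show ?case by simp
  qed
  have mom_meas: "mom t \<in> borel_measurable (F t)" for t using meas by simp
  have e_meas: "e t \<in> borel_measurable (F t)" for t
    unfolding e_def using meas[of t] by (intro borel_measurable_diff) auto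
  have row: "(AE \<omega> in M. e t \<omega> \<in> ?V) \<and> (AE \<omega> in M. mom t \<omega> \<in> ?V)" for t
  proof (induction t)
    case 0
    then show ?case
      using x0_row_space xstar_row by (auto simp: e_def x_0 mom_0 span_zero intro!: AE_I2 span_diff)
  next
    case (Suc t)
    then have IH: "AE \<omega> in M. e t \<omega> \<in> ?V" "AE \<omega> in M. mom t \<omega> \<in> ?V" by auto
    have mom: "AE \<omega> in M. mom (Suc t) \<omega> \<in> ?V"
      using IH(2) wt_row_space[of t] AE_space
      by eventually_elim (auto simp: mom_Suc intro!: span_scale span_diff)
    moreover have "AE \<omega> in M. e (Suc t) \<omega> \<in> ?V"
      using IH(1) wt_row_space[of t] mom AE_space
    proof eventually_elim
      case (elim \<omega>)
      have "e (Suc t) \<omega> = e t \<omega> - wt t \<omega> + eta *\<^sub>R mom (Suc t) \<omega>" using elim by (simp add: e_def x_Suc)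
      then show ?case using elim by (simp add: span_add span_diff span_scale)
    qed
    ultimately show ?case by simp
  qed
  define e0 where "e0 = x0 - xstar"
  \<comment> \<open>for \<open>A = 0\<close> the spectral constants are meaningless, but then the row space is trivial\<close>
  show ?thesis
  proof (cases "A = 0")
    case True
    then have V: "v = 0" if "v \<in> ?V" for v
      using that nullspace_inter_rowspace[of A v] by simp
    have "AE \<omega> in M. (norm (x t \<omega> - xstar))\<^sup>2 = 0"
      using conjunct1[OF row[of t]] by eventually_elim (auto simp: e_def dest: V)
    then have "expectation (\<lambda>\<omega>. (norm (x t \<omega> - xstar))\<^sup>2) = 0"
      by (rule integral_eq_zero_AE)
    moreover have "x0 - xstar = 0" using x0_row_space xstar_row by (intro V span_diff)
    ultimately show ?thesis by simp
  next
    case False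
    interpret momentum_parameters A lam D rho eta c
      using lam null_space c rho eta False unfolding mu nu rhobar by unfold_locales auto
    have step: "(\<integral>\<^sup>+\<omega>. potential (e (Suc t) \<omega>) (mom (Suc t) \<omega>) \<partial>M)
        \<le> ennreal (1 - rho / 2) * (\<integral>\<^sup>+\<omega>. potential (e t \<omega>) (mom t \<omega>) \<partial>M)" for t
    proof (rule expected_potential_step[OF prob_space_axioms filtration(2)[of t] _ S_distr S_indep e_meas mom_meas])
      show "S t \<in> M \<rightarrow>\<^sub>M count_space UNIV"
        by (rule measurable_from_subalg[OF filtration(2) S_adapted])
      show "AE \<omega> in M. norm (wt t \<omega> - reg_proj A lam (S t \<omega>) *v e t \<omega>) \<le> rho\<^sup>2 / (8 * eta) * norm (e t \<omega>)"
        using inexact[of t] unfolding reg_step_eq_reg_proj[OF Axstar] e_def .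
      show "AE \<omega> in M. e (Suc t) \<omega> = e t \<omega> - wt t \<omega> + eta *\<^sub>R mom (Suc t) \<omega>"
        by (rule AE_I2) (simp add: e_def x_Suc)
    qed (use row mom_Suc in auto)
    have decay: "(\<integral>\<^sup>+\<omega>. potential (e t \<omega>) (mom t \<omega>) \<partial>M) \<le> ennreal ((1 - rho / 2) ^ t * potential e0 0)" for t
    proof (induction t)
      case 0
      have "(\<integral>\<^sup>+\<omega>. potential (e 0 \<omega>) (mom 0 \<omega>) \<partial>M) = (\<integral>\<^sup>+\<omega>. potential e0 0 \<partial>M)"
        by (intro nn_integral_cong) (simp add: e_def x_0 mom_0 e0_def)
      then show ?case by (simp add: emeasure_space_1)
    next
      case (Suc t)
      have "ennreal (1 - rho / 2) * (\<integral>\<^sup>+\<omega>. potential (e t \<omega>) (mom t \<omega>) \<partial>M)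
          \<le> ennreal (1 - rho / 2) * ennreal ((1 - rho / 2) ^ t * potential e0 0)"
        by (intro mult_left_mono Suc) simp
      also have "\<dots> = ennreal ((1 - rho / 2) ^ Suc t * potential e0 0)"
        using rho_le_half by (simp add: ennreal_mult[symmetric] potential_nonneg mult.assoc)
      finally show ?case using step[of t] by (rule order_trans[rotated])
    qed
    have "(\<integral>\<^sup>+\<omega>. ennreal ((norm (x t \<omega> - xstar))\<^sup>2) \<partial>M)
        \<le> (\<integral>\<^sup>+\<omega>. ennreal (2 / gain) * potential (e t \<omega>) (mom t \<omega>) \<partial>M)"
    proof (rule nn_integral_mono_AE)
      show "AE \<omega> in M. ennreal ((norm (x t \<omega> - xstar))\<^sup>2) \<le> ennreal (2 / gain) * potential (e t \<omega>) (mom t \<omega>)"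
        using conjunct1[OF row[of t]] conjunct2[OF row[of t]]
      proof eventually_elim
        case (elim \<omega>)
        have "(norm (e t \<omega>))\<^sup>2 \<le> 2 / gain * potential (e t \<omega>) (mom t \<omega>)"
          using norm_square_le_potential[OF elim] gain_pos by (simp add: power2_norm_eq_inner field_simps)
        then show ?case using gain_pos
          by (simp add: e_def ennreal_mult[symmetric] potential_nonneg ennreal_leI)
      qed
    qed
    also have "\<dots> = ennreal (2 / gain) * (\<integral>\<^sup>+\<omega>. potential (e t \<omega>) (mom t \<omega>) \<partial>M)"
      using measurable_from_subalg[OF filtration(2) measurable_potential(1)[OF e_meas mom_meas, of t]]
      by (intro nn_integral_cmult) simp
    also have "\<dots> \<le> ennreal (2 / gain) * ennreal ((1 - rho / 2) ^ t * potential e0 0)"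
      by (intro mult_left_mono decay) simp
    also have "\<dots> = ennreal (2 / gain * ((1 - rho / 2) ^ t * potential e0 0))"
      using gain_pos rho_le_half by (intro ennreal_mult[symmetric]) (simp_all add: potential_nonneg)
    also have "\<dots> \<le> ennreal (8 * (1 - rho / 2) ^ t * (norm (x0 - xstar))\<^sup>2)"
    proof (rule ennreal_leI)
      have "2 / gain * ((1 - rho / 2) ^ t * potential e0 0)
          \<le> 2 / gain * ((1 - rho / 2) ^ t * (2 * gain * (e0 \<bullet> e0)))"
        using gain_pos rho_le_half by (intro mult_left_mono potential_initial_le) auto
      also have "\<dots> = 4 * ((1 - rho / 2) ^ t * (norm e0)\<^sup>2)"
        using gain_pos by (simp add: power2_norm_eq_inner)
      also have "\<dots> \<le> 8 * ((1 - rho / 2) ^ t * (norm e0)\<^sup>2)"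
        using rho_le_half by (intro mult_right_mono) auto
      finally show "2 / gain * ((1 - rho / 2) ^ t * potential e0 0)
          \<le> 8 * (1 - rho / 2) ^ t * (norm (x0 - xstar))\<^sup>2"
        by (simp add: e0_def mult.assoc)
    qed
    finally show ?thesis
      using rho_le_half by (intro integral_real_bounded) simp_all
  qed
qed

end
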